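(* Let $G$ be a locally compact group and let $S^1(G)$ be a symmetric Segal algebra in $L^1(G)$. Then for every continuous derivation $D:S^1(G)\to S^1(G)^*$, the map $\pi^*\circ D:S^1(G)\to(S^1(G)\widehat{\otimes}S^1(G))^*$ is $w^*$-approximately inner.
   Context: A Segal algebra $S^1(G)$ in $L^1(G)$ is a dense subspace of the convolution algebra $L^1(G)$ which is a left ideal of $L^1(G)$, is complete under a norm $\|\cdot\|_{S^1}$ for which it is a contractive left $L^1(G)$-module ($\|f*g\|_{S^1}\le\|f\|_1\|g\|_{S^1}$) that is essential ($L^1(G)*S^1(G)$ is $\|\cdot\|_{S^1}$-dense), is contractively embedded in $L^1(G)$ ($\|f\|_1\le\|f\|_{S^1}$), and is closed under left translations $L_xf(y)=f(x^{-1}y)$, with $(x,f)\mapsto L_xf:G\times S^1(G)\to S^1(G)$ continuous and $\|L_xf\|_{S^1}=\|f\|_{S^1}$. It is symmetric if it is also a contractive essential right $L^1(G)$-module under convolution (equivalently, it is closed under $R_xf(y)=f(yx^{-1})\Delta(x^{-1})$, $x\in G$, with these actions continuous and isometric). $\widehat{\otimes}$ is the projective tensor product; $\pi:S^1(G)\widehat{\otimes}S^1(G)\to S^1(G)$, $\pi(g\otimes h)=g*h$. $S^1(G)\widehat{\otimes}S^1(G)$ is an $S^1(G)$-bimodule via $f\cdot(g\otimes h)=(f*g)\otimes h$, $(g\otimes h)\cdot f=g\otimes(h*f)$, and duals carry the dual actions $\langle x,f\cdot\psi\rangle=\langle x\cdot f,\psi\rangle$, $\langle x,\psi\cdot f\rangle=\langle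 f\cdot x,\psi\rangle$. A derivation $d:A\to X^*$ into a dual bimodule is $w^*$-approximately inner if there is a net $(\psi_\alpha)$ in $X^*$ with $d(f)=w^*\text{-}\lim_\alpha(f\cdot\psi_\alpha-\psi_\alpha\cdot f)$ for every $f\in A$. *)

theory Defs
  imports
    "HOL-Analysis.Analysis"
    "HOL-Library.Function_Algebras"
    "HOL-Library.Poly_Mapping"
begin

section \<open>Complex seminormed spaces, algebras and bimodules with carriers\<close>

text \<open>
  The spaces below consist of functions up to equality almost everywhere, of formal sums up to
  bilinear relations, and of Cauchy sequences up to null sequences.  Throughout, a normed space is
  given by representatives and a seminorm on them; the space meant is the quotient by the elements
  of seminorm zero.  Bounded maps and functionals on representatives automatically descend
  to the quotient.
\<close>

record 'x snspace =
  carr :: "'x set"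
  scal :: "complex \<Rightarrow> 'x \<Rightarrow> 'x"
  snorm :: "'x \<Rightarrow> real"

record 'a snalgebra = "'a snspace" +
  mult :: "'a \<Rightarrow> 'a \<Rightarrow> 'a"

record ('a, 'x) bimodule = "'x snspace" +
  lact :: "'a \<Rightarrow> 'x \<Rightarrow> 'x"
  ract :: "'x \<Rightarrow> 'a \<Rightarrow> 'x"

definition dual_space :: "('x::ab_group_add, 'm) snspace_scheme \<Rightarrow> ('x \<Rightarrow> complex) set" where
  "dual_space X = {\<psi>.
     (\<forall>x\<in>carr X. \<forall>y\<in>carr X. \<psi> (x + y) = \<psi> x + \<psi> y) \<and>
     (\<forall>c. \<forall>x\<in>carr X. \<psi> (scal X c x) = c * \<psi> x) \<and>
     (\<exists>C. \<forall>x\<in>carr X. cmod (\<psi> x) \<le> C * snorm X x)}"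

definition dual_lact :: "('a, 'x) bimodule \<Rightarrow> 'a \<Rightarrow> ('x \<Rightarrow> complex) \<Rightarrow> 'x \<Rightarrow> complex" where
  "dual_lact X f \<psi> = (\<lambda>x. \<psi> (ract X x f))"

definition dual_ract :: "('a, 'x) bimodule \<Rightarrow> ('x \<Rightarrow> complex) \<Rightarrow> 'a \<Rightarrow> 'x \<Rightarrow> complex" where
  "dual_ract X \<psi> f = (\<lambda>x. \<psi> (lact X f x))"

definition regular_bimodule :: "'a snalgebra \<Rightarrow> ('a, 'a) bimodule" where
  "regular_bimodule A =
     \<lparr>carr = carr A, scal = scal A, snorm = snorm A, lact = mult A, ract = mult A\<rparr>"

text \<open>
  Elements of a dual are only compared on the carrier, since the values of a functional outside of
  it carry no information.
\<close>

definition continuous_derivation ::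
  "'a::ab_group_add snalgebra \<Rightarrow> ('a, 'x::ab_group_add) bimodule \<Rightarrow> ('a \<Rightarrow> 'x \<Rightarrow> complex) \<Rightarrow> bool"
where
  "continuous_derivation A X D \<longleftrightarrow>
     (\<forall>f\<in>carr A. D f \<in> dual_space X) \<and>
     (\<forall>f\<in>carr A. \<forall>g\<in>carr A. \<forall>x\<in>carr X. D (f + g) x = D f x + D g x) \<and>
     (\<forall>c. \<forall>f\<in>carr A. \<forall>x\<in>carr X. D (scal A c f) x = c * D f x) \<and>
     (\<exists>C. \<forall>f\<in>carr A. \<forall>x\<in>carr X. cmod (D f x) \<le> C * snorm A f * snorm X x) \<and>
     (\<forall>f\<in>carr A. \<forall>g\<in>carr A. \<forall>x\<in>carr X.
        D (mult A f g) x = dual_lact X f (D g) x + dual_ract X (D f) g x)"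

text \<open>
  Nets in the dual are rendered as proper filters on it: a net gives the filter of
  sets that eventually contain it, and a proper filter \<open>F\<close> gives the net of all pairs
  of a set in \<open>F\<close> and a point of this set.
\<close>

definition wstar_approx_inner ::
  "'a snalgebra \<Rightarrow> ('a, 'x::ab_group_add) bimodule \<Rightarrow> ('a \<Rightarrow> 'x \<Rightarrow> complex) \<Rightarrow> bool"
where
  "wstar_approx_inner A X d \<longleftrightarrow>
     (\<exists>F :: ('x \<Rightarrow> complex) filter. F \<noteq> bot \<and> (\<forall>\<^sub>F \<psi> in F. \<psi> \<in> dual_space X) \<and>
        (\<forall>f\<in>carr A. \<forall>x\<in>carr X.
           ((\<lambda>\<psi>. dual_lact X f \<psi> x - dual_ract X \<psi> f x) \<longlongrightarrow> d f x) F))"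


section \<open>The projective tensor product\<close>

definition completion :: "'x::ab_group_add snspace \<Rightarrow> (nat \<Rightarrow> 'x) snspace" where
  "completion X =
     \<lparr>carr = {u. (\<forall>n. u n \<in> carr X) \<and>
                 (\<forall>e>0. \<exists>M. \<forall>m\<ge>M. \<forall>n\<ge>M. snorm X (u m - u n) < e)},
      scal = (\<lambda>c u n. scal X c (u n)),
      snorm = (\<lambda>u. lim (\<lambda>n. snorm X (u n)))\<rparr>"

text \<open>
  The algebraic tensor product is the free complex vector space on pairs modulo the bilinear
  relations; \<open>elem_tensor x y\<close> represents the elementary tensor.
\<close>

type_synonym ('x, 'y) ftensor = "('x \<times> 'y) \<Rightarrow>\<^sub>0 complex"

definition ft_scale :: "complex \<Rightarrow> ('x, 'y) ftensor \<Rightarrow> ('x, 'y) ftensor" where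
  "ft_scale c F = Poly_Mapping.map (\<lambda>a. c * a) F"

definition elem_tensor :: "'x \<Rightarrow> 'y \<Rightarrow> ('x, 'y) ftensor" where
  "elem_tensor x y = Poly_Mapping.single (x, y) 1"

lemma vector_space_ft_scale: "vector_space ft_scale"
proof
  fix a b :: complex and F G :: "('x, 'y) ftensor"
  have l: "Poly_Mapping.lookup (ft_scale c H) k = c * Poly_Mapping.lookup H k"
    for c k and H :: "('x, 'y) ftensor"
    by (simp add: ft_scale_def Poly_Mapping.map.rep_eq when_def)
  show "ft_scale a (F + G) = ft_scale a F + ft_scale a G"
    by (rule poly_mapping_eqI) (simp add: l lookup_add algebra_simps)
  show "ft_scale (a + b) F = ft_scale a F + ft_scale b F"
    by (rule poly_mapping_eqI) (simp add: l lookup_add algebra_simps)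
  show "ft_scale a (ft_scale b F) = ft_scale (a * b) F"
    by (rule poly_mapping_eqI) (simp add: l)
  show "ft_scale 1 F = F"
    by (rule poly_mapping_eqI) (simp add: l)
qed

definition bilinear_relations ::
  "('x::ab_group_add, 'm) snspace_scheme \<Rightarrow> ('y::ab_group_add, 'n) snspace_scheme \<Rightarrow>
   ('x, 'y) ftensor set"
where
  "bilinear_relations X Y = module.span ft_scale
     ({elem_tensor (x + x') y - elem_tensor x y - elem_tensor x' y | x x' y.
         x \<in> carr X \<and> x' \<in> carr X \<and> y \<in> carr Y} \<union>
      {elem_tensor x (y + y') - elem_tensor x y - elem_tensor x y' | x y y'.
         x \<in> carr X \<and> y \<in> carr Y \<and> y' \<in> carr Y} \<union>
      {elem_tensor (scal X c x) y - ft_scale c (elem_tensor x y) | c x y.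
         x \<in> carr X \<and> y \<in> carr Y} \<union>
      {elem_tensor x (scal Y c y) - ft_scale c (elem_tensor x y) | c x y.
         x \<in> carr X \<and> y \<in> carr Y})"

definition proj_seminorm ::
  "('x::ab_group_add, 'm) snspace_scheme \<Rightarrow> ('y::ab_group_add, 'n) snspace_scheme \<Rightarrow>
   ('x, 'y) ftensor \<Rightarrow> real"
where
  "proj_seminorm X Y F = Inf {(\<Sum>i<n. snorm X (x i) * snorm Y (y i)) | (n::nat) x y.
     (\<forall>i<n. x i \<in> carr X \<and> y i \<in> carr Y) \<and>
     F - (\<Sum>i<n. elem_tensor (x i) (y i)) \<in> bilinear_relations X Y}"

definition alg_tensor ::
  "('x::ab_group_add, 'm) snspace_scheme \<Rightarrow> ('y::ab_group_add, 'n) snspace_scheme \<Rightarrow>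
   ('x, 'y) ftensor snspace"
where
  "alg_tensor X Y =
     \<lparr>carr = {F. Poly_Mapping.keys F \<subseteq> carr X \<times> carr Y},
      scal = ft_scale,
      snorm = proj_seminorm X Y\<rparr>"

definition proj_tensor ::
  "('x::ab_group_add, 'm) snspace_scheme \<Rightarrow> ('y::ab_group_add, 'n) snspace_scheme \<Rightarrow>
   (nat \<Rightarrow> ('x, 'y) ftensor) snspace"
where
  "proj_tensor X Y = completion (alg_tensor X Y)"

text \<open>
  The linear extension of \<open>x \<otimes> y \<mapsto> b x y\<close> to formal sums, with values in a space with scalar
  multiplication \<open>s\<close>.
\<close>

definition ft_lift ::
  "(complex \<Rightarrow> 'z \<Rightarrow> 'z) \<Rightarrow> ('x \<Rightarrow> 'y \<Rightarrow> 'z) \<Rightarrow> ('x, 'y) ftensor \<Rightarrow> 'z::ab_group_add"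
where
  "ft_lift s b F =
     (\<Sum>(x, y)\<in>Poly_Mapping.keys F. s (Poly_Mapping.lookup F (x, y)) (b x y))"

definition tensor_bimodule ::
  "'a::ab_group_add snalgebra \<Rightarrow> ('a, nat \<Rightarrow> ('a, 'a) ftensor) bimodule"
where
  "tensor_bimodule A =
     \<lparr>carr = carr (proj_tensor A A),
      scal = scal (proj_tensor A A),
      snorm = snorm (proj_tensor A A),
      lact = (\<lambda>f u n. ft_lift ft_scale (\<lambda>g h. elem_tensor (mult A f g) h) (u n)),
      ract = (\<lambda>u f n. ft_lift ft_scale (\<lambda>g h. elem_tensor g (mult A h f)) (u n))\<rparr>"

text \<open>
  The product map of a complete algebra: on a Cauchy sequence of formal sums it is the limit of
  the products, which is unique up to an element of seminorm zero.
\<close>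

definition tensor_mult ::
  "'a::ab_group_add snalgebra \<Rightarrow> (nat \<Rightarrow> ('a, 'a) ftensor) \<Rightarrow> 'a"
where
  "tensor_mult A u = (SOME f. f \<in> carr A \<and>
     (\<lambda>n. snorm A (ft_lift (scal A) (mult A) (u n) - f)) \<longlonglongrightarrow> 0)"


section \<open>Segal algebras\<close>

text \<open>
  The group is written additively, but is not assumed to be commutative: \<open>x + y\<close>
  is the group product and \<open>- x\<close> is the inverse.
  A left Haar measure is a nonzero left invariant Radon measure on the Borel sets.
\<close>

definition left_haar_measure :: "'g::{topological_group_add, t2_space} measure \<Rightarrow> bool" where
  "left_haar_measure \<mu> \<longleftrightarrow>
     sets \<mu> = sets borel \<and>
     emeasure \<mu> UNIV \<noteq> 0 \<and>
     (\<forall>K. compact K \<longrightarrow> emeasure \<mu> K < \<infinity>) \<and>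
     (\<forall>A\<in>sets borel. emeasure \<mu> A = (INF U\<in>{U. open U \<and> A \<subseteq> U}. emeasure \<mu> U)) \<and>
     (\<forall>U. open U \<longrightarrow> emeasure \<mu> U = (SUP K\<in>{K. compact K \<and> K \<subseteq> U}. emeasure \<mu> K)) \<and>
     (\<forall>x. \<forall>A\<in>sets borel. emeasure \<mu> ((\<lambda>y. x + y) ` A) = emeasure \<mu> A)"

definition fscale :: "complex \<Rightarrow> ('g \<Rightarrow> complex) \<Rightarrow> 'g \<Rightarrow> complex" where
  "fscale c f = (\<lambda>x. c * f x)"

lemma vector_space_fscale: "vector_space fscale"
  by unfold_locales (auto simp: fscale_def algebra_simps)

definition L1 :: "'g measure \<Rightarrow> ('g \<Rightarrow> complex) set" where
  "L1 \<mu> = {f. integrable \<mu> f}"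

definition norm1 :: "'g measure \<Rightarrow> ('g \<Rightarrow> complex) \<Rightarrow> real" where
  "norm1 \<mu> f = (LINT x|\<mu>. cmod (f x))"

text \<open>
  For integrable \<open>f\<close> and \<open>g\<close> the integrand is integrable for almost every \<open>x\<close>; at the other
  points the Bochner integral is zero by convention.
\<close>

definition conv ::
  "'g::group_add measure \<Rightarrow> ('g \<Rightarrow> complex) \<Rightarrow> ('g \<Rightarrow> complex) \<Rightarrow> 'g \<Rightarrow> complex"
where
  "conv \<mu> f g = (\<lambda>x. LINT y|\<mu>. f y * g (- y + x))"

definition ltrans :: "'g::group_add \<Rightarrow> ('g \<Rightarrow> complex) \<Rightarrow> 'g \<Rightarrow> complex" where
  "ltrans x f = (\<lambda>y. f (- x + y))"

definition dense_in ::
  "('x::ab_group_add \<Rightarrow> real) \<Rightarrow> 'x set \<Rightarrow> 'x set \<Rightarrow> bool"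
where
  "dense_in N T V \<longleftrightarrow> T \<subseteq> V \<and> (\<forall>f\<in>V. \<forall>e>0. \<exists>g\<in>T. N (f - g) < e)"

text \<open>
  A subspace of \<open>L\<^sup>1\<close> is given by all integrable functions whose class belongs to it, and a norm
  on it by a seminorm whose null space consists of the functions vanishing almost everywhere.
\<close>

definition segal_algebra ::
  "'g::{topological_group_add, t2_space} measure \<Rightarrow> ('g \<Rightarrow> complex) set \<Rightarrow>
   (('g \<Rightarrow> complex) \<Rightarrow> real) \<Rightarrow> bool"
where
  "segal_algebra \<mu> S N \<longleftrightarrow>
     \<comment> \<open>dense subspace of \<open>L\<^sup>1\<close>\<close>
     module.subspace fscale S \<and> dense_in (norm1 \<mu>) S (L1 \<mu>) \<and>
     (\<forall>f\<in>S. \<forall>g\<in>L1 \<mu>. (AE x in \<mu>. f x = g x) \<longrightarrow> g \<in> S) \<and>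
     \<comment> \<open>complete norm\<close>
     (\<forall>f\<in>S. \<forall>g\<in>S. N (f + g) \<le> N f + N g) \<and>
     (\<forall>c. \<forall>f\<in>S. N (fscale c f) = cmod c * N f) \<and>
     (\<forall>f\<in>S. N f = 0 \<longleftrightarrow> (AE x in \<mu>. f x = 0)) \<and>
     (\<forall>u. (\<forall>n::nat. u n \<in> S) \<and> (\<forall>e>0. \<exists>M. \<forall>m\<ge>M. \<forall>n\<ge>M. N (u m - u n) < e) \<longrightarrow>
          (\<exists>f\<in>S. (\<lambda>n. N (u n - f)) \<longlonglongrightarrow> 0)) \<and>
     \<comment> \<open>left ideal and contractive essential left \<open>L\<^sup>1\<close>-module\<close>
     (\<forall>f\<in>L1 \<mu>. \<forall>g\<in>S. conv \<mu> f g \<in> S \<and> N (conv \<mu> f g) \<le> norm1 \<mu> f * N g) \<and>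
     dense_in N (module.span fscale {conv \<mu> f g | f g. f \<in> L1 \<mu> \<and> g \<in> S}) S \<and>
     \<comment> \<open>contractive embedding into \<open>L\<^sup>1\<close>\<close>
     (\<forall>f\<in>S. norm1 \<mu> f \<le> N f) \<and>
     \<comment> \<open>isometric, jointly continuous left translations\<close>
     (\<forall>x. \<forall>f\<in>S. ltrans x f \<in> S \<and> N (ltrans x f) = N f) \<and>
     (\<forall>x0. \<forall>f0\<in>S. \<forall>e>0. \<exists>d>0. \<forall>\<^sub>F x in nhds x0. \<forall>f\<in>S.
          N (f - f0) < d \<longrightarrow> N (ltrans x f - ltrans x0 f0) < e)"

definition symmetric_segal_algebra ::
  "'g::{topological_group_add, t2_space} measure \<Rightarrow> ('g \<Rightarrow> complex) set \<Rightarrow>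
   (('g \<Rightarrow> complex) \<Rightarrow> real) \<Rightarrow> bool"
where
  "symmetric_segal_algebra \<mu> S N \<longleftrightarrow>
     segal_algebra \<mu> S N \<and>
     (\<forall>f\<in>L1 \<mu>. \<forall>g\<in>S. conv \<mu> g f \<in> S \<and> N (conv \<mu> g f) \<le> N g * norm1 \<mu> f) \<and>
     dense_in N (module.span fscale {conv \<mu> g f | g f. g \<in> S \<and> f \<in> L1 \<mu>}) S"

definition conv_algebra ::
  "'g::group_add measure \<Rightarrow> ('g \<Rightarrow> complex) set \<Rightarrow> (('g \<Rightarrow> complex) \<Rightarrow> real) \<Rightarrow>
   ('g \<Rightarrow> complex) snalgebra"
where
  "conv_algebra \<mu> S N = \<lparr>carr = S, scal = fscale, snorm = N, mult = conv \<mu>\<rparr>"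

end

theory Submission
  imports Defs
begin

text \<open>
  Every continuous derivation \<open>D : A \<rightarrow> A\<^sup>*\<close> of a Banach algebra becomes inner, not only
  approximately inner, after composition with \<open>\<pi>\<^sup>*\<close>.  The functional
  \<open>\<psi>(g \<otimes> h) = D h g\<close> implements it:
  \<open>(f \<cdot> \<psi> - \<psi> \<cdot> f)(g \<otimes> h) = D (h * f) g - D h (f * g) = D f (g * h)\<close>
  by the derivation identity.

  The analytic content is that convolution of functions is bilinear up to null functions, i.e. that
  \<open>y \<mapsto> f y * g (- y + x)\<close> is integrable for almost every \<open>x\<close>.  As the group need be neither
  \<open>\<sigma>\<close>-finite nor second countable, this function of two variables need not be measurable for the
  product of the Borel algebras, and Tonelli's theorem does not apply directly.  Instead \<open>f\<close> and \<open>g\<close>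
  are dominated by countable sums of indicators of open sets (outer regularity); for open sets
  \<open>U\<close>, \<open>V\<close> the section function \<open>x \<mapsto> \<mu> {y \<in> V. - y + x \<in> U}\<close> is lower semicontinuous and
  its integral is approximated from finite unions of rectangles (inner regularity), where Tonelli's
  theorem applies.  Layers at powers of two lose constant factors, which are harmless here.
\<close>

section \<open>The projective tensor product\<close>


lemma lookup_ft_scale: "Poly_Mapping.lookup (ft_scale c F) k = c * Poly_Mapping.lookup F k"
  by (simp add: ft_scale_def Poly_Mapping.map.rep_eq when_def)

interpretation ft: vector_space ft_scale
  by (rule vector_space_ft_scale)

text \<open>Keys outside the support have coefficient zero; a common index set makes sums over
  different supports comparable.\<close>

lemma ft_lift_superset:
  assumes "vector_space s" and "finite K" and "Poly_Mapping.keys F \<subseteq> K"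
  shows "ft_lift s b F = (\<Sum>(x, y)\<in>K. s (Poly_Mapping.lookup F (x, y)) (b x y))"
proof -
  interpret vector_space s by fact
  show ?thesis
    unfolding ft_lift_def using assms(2,3)
    by (intro sum.mono_neutral_left) (auto simp: in_keys_iff)
qed

lemma linear_ft_lift:
  fixes b :: "'x \<Rightarrow> 'y \<Rightarrow> 'z::ab_group_add"
  assumes "vector_space s"
  shows "Vector_Spaces.linear ft_scale s (ft_lift s b)"
proof -
  interpret s: vector_space s by fact
  show ?thesis
  proof unfold_locales
    fix F G :: "('x, 'y) ftensor"
    let ?K = "Poly_Mapping.keys F \<union> Poly_Mapping.keys G"
    have "ft_lift s b (F + G) = (\<Sum>(x, y)\<in>?K. s (Poly_Mapping.lookup (F + G) (x, y)) (b x y))"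
      using keys_add[of F G] by (intro ft_lift_superset assms) auto
    also have "\<dots> = ft_lift s b F + ft_lift s b G"
      by (simp add: ft_lift_superset[OF assms, of ?K] lookup_add s.scale_left_distrib
          sum.distrib case_prod_unfold)
    finally show "ft_lift s b (F + G) = ft_lift s b F + ft_lift s b G" .
  next
    fix c and F :: "('x, 'y) ftensor"
    have "ft_lift s b (ft_scale c F)
        = (\<Sum>(x, y)\<in>Poly_Mapping.keys F. s (Poly_Mapping.lookup (ft_scale c F) (x, y)) (b x y))"
      by (intro ft_lift_superset assms) (auto simp: in_keys_iff lookup_ft_scale)
    also have "\<dots> = s c (ft_lift s b F)"
      by (simp add: ft_lift_def lookup_ft_scale s.scale_sum_right case_prod_unfold)
    finally show "ft_lift s b (ft_scale c F) = s c (ft_lift s b F)" .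
  qed
qed

lemma ft_lift_elem_tensor:
  assumes "vector_space s"
  shows "ft_lift s b (elem_tensor x y) = b x y"
proof -
  interpret vector_space s by fact
  show ?thesis by (simp add: ft_lift_def elem_tensor_def)
qed

lemma ft_eq_sum_elem_tensor:
  "F = (\<Sum>k\<in>Poly_Mapping.keys F. ft_scale (Poly_Mapping.lookup F k) (elem_tensor (fst k) (snd k)))"
  by (rule poly_mapping_eqI)
    (simp add: lookup_sum lookup_ft_scale elem_tensor_def lookup_single when_def in_keys_iff
      if_distrib[of "\<lambda>z. _ * z"] cong: if_cong)

text \<open>With \<open>p\<close> and \<open>q\<close> given by a module action, this moves the
  action from the formal sum into the form \<open>b\<close>.\<close>

lemma ft_lift_elem_tensor_compose:
  assumes "vector_space s"
  shows "ft_lift s b (ft_lift ft_scale (\<lambda>x y. elem_tensor (p x y) (q x y)) F)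
    = ft_lift s (\<lambda>x y. b (p x y) (q x y)) F"
proof -
  interpret Vector_Spaces.linear ft_scale s "ft_lift s b"
    by (rule linear_ft_lift[OF assms])
  show ?thesis
    unfolding ft_lift_def[of ft_scale] ft_lift_def[of s "\<lambda>x y. b (p x y) (q x y)"]
    by (simp add: sum scale ft_lift_elem_tensor[OF assms] case_prod_unfold)
qed

section \<open>Seminormed spaces given by representatives\<close>

locale seminormed_space = vector_space "scal X" for X :: "('x::ab_group_add, 'm) snspace_scheme" +
  assumes subspace_carr: "subspace (carr X)"
    and snorm_triangle: "x \<in> carr X \<Longrightarrow> y \<in> carr X \<Longrightarrow> snorm X (x + y) \<le> snorm X x + snorm X y"
    and snorm_scal: "x \<in> carr X \<Longrightarrow> snorm X (scal X c x) = cmod c * snorm X x"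
begin

lemma carr_closed [simp]:
  "0 \<in> carr X" "x \<in> carr X \<Longrightarrow> y \<in> carr X \<Longrightarrow> x + y \<in> carr X"
  "x \<in> carr X \<Longrightarrow> y \<in> carr X \<Longrightarrow> x - y \<in> carr X"
  "x \<in> carr X \<Longrightarrow> scal X c x \<in> carr X" "x \<in> carr X \<Longrightarrow> - x \<in> carr X"
  using subspace_carr by (simp_all add: subspace_0 subspace_add subspace_diff subspace_scale subspace_neg)

lemma sum_closed: "(\<And>i. i \<in> I \<Longrightarrow> x i \<in> carr X) \<Longrightarrow> sum x I \<in> carr X"
  by (rule subspace_sum[OF subspace_carr])

lemma snorm_zero [simp]: "snorm X 0 = 0"
  using snorm_scal[of 0 0] by simp

lemma snorm_minus [simp]: "x \<in> carr X \<Longrightarrow> snorm X (- x) = snorm X x"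
  using snorm_scal[of x "-1"] by simp

lemma snorm_nonneg [simp]: "x \<in> carr X \<Longrightarrow> 0 \<le> snorm X x"
  using snorm_triangle[of x "- x"] by simp

lemma snorm_sum: "(\<And>i. i \<in> I \<Longrightarrow> x i \<in> carr X) \<Longrightarrow> snorm X (sum x I) \<le> (\<Sum>i\<in>I. snorm X (x i))"
proof (induction I rule: infinite_finite_induct)
  case (insert j I)
  have "snorm X (x j + sum x I) \<le> snorm X (x j) + snorm X (sum x I)"
    using insert.prems by (intro snorm_triangle sum_closed) auto
  then show ?case using insert by force
qed auto

text \<open>These are the elements identified with zero in the quotient; the subspace property is
  what span induction over the bilinear relations needs.\<close>

lemma subspace_null: "subspace {x \<in> carr X. snorm X x = 0}"
proof (rule subspaceI)
  fix x y assume "x \<in> {x \<in> carr X. snorm X x = 0}" "y \<in> {x \<in> carr X. snorm X x = 0}"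
  then show "x + y \<in> {x \<in> carr X. snorm X x = 0}"
    using snorm_triangle[of x y] snorm_nonneg[of "x + y"] by (auto intro: antisym)
qed (auto simp: snorm_scal)

end

section \<open>Representations by elementary tensors and the projective seminorm\<close>

lemma sum_append:
  fixes f :: "nat \<Rightarrow> 'z::comm_monoid_add"
  shows "(\<Sum>i<n+m. if i < n then f i else g (i - n)) = sum f {..<n} + sum g {..<m}"
proof (induction m)
  case 0
  then show ?case by (simp cong: sum.cong_simp)
qed (simp add: add.assoc)

text \<open>Names the competitors in the infimum that defines \<open>proj_seminorm\<close>; they
  carry no coefficients, since scalars can be absorbed into a factor.\<close>

definition tensor_rep ::
  "('x::ab_group_add, 'm) snspace_scheme \<Rightarrow> ('y::ab_group_add, 'n) snspace_scheme \<Rightarrow>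
   ('x, 'y) ftensor \<Rightarrow> nat \<Rightarrow> (nat \<Rightarrow> 'x) \<Rightarrow> (nat \<Rightarrow> 'y) \<Rightarrow> bool"
where
  "tensor_rep X Y F n x y \<longleftrightarrow> (\<forall>i<n. x i \<in> carr X \<and> y i \<in> carr Y) \<and>
     F - (\<Sum>i<n. elem_tensor (x i) (y i)) \<in> bilinear_relations X Y"

lemma proj_seminorm_rep:
  "proj_seminorm X Y F = Inf {(\<Sum>i<n. snorm X (x i) * snorm Y (y i)) | n x y. tensor_rep X Y F n x y}"
  unfolding proj_seminorm_def tensor_rep_def ..

locale seminormed_pair = X: seminormed_space X + Y: seminormed_space Y
  for X :: "('x::ab_group_add, 'm) snspace_scheme" and Y :: "('y::ab_group_add, 'n) snspace_scheme"
begin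

text \<open>Each coefficient of \<open>F\<close> is absorbed into the left factor, at the cost of
  one homogeneity relation per key. This supplies the nonemptiness that a real infimum
  needs.\<close>

lemma ex_tensor_rep:
  assumes "Poly_Mapping.keys F \<subseteq> carr X \<times> carr Y"
  shows "\<exists>n x y. tensor_rep X Y F n x y"
proof -
  let ?c = "Poly_Mapping.lookup F"
  obtain h where h: "bij_betw h {..<card (Poly_Mapping.keys F)} (Poly_Mapping.keys F)"
    using ex_bij_betw_nat_finite[OF finite_keys] by (auto simp: atLeast0LessThan)
  define n where "n = card (Poly_Mapping.keys F)"
  have h_mem: "h i \<in> Poly_Mapping.keys F" if "i < n" for i
    using h that by (auto simp: bij_betw_def n_def)
  have carr: "fst (h i) \<in> carr X" "snd (h i) \<in> carr Y" if "i < n" for i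
    using h_mem[OF that] assms by auto
  have "F = (\<Sum>i<n. ft_scale (?c (h i)) (elem_tensor (fst (h i)) (snd (h i))))"
    by (subst ft_eq_sum_elem_tensor) (simp add: n_def sum.reindex_bij_betw[OF h, symmetric])
  then have "F - (\<Sum>i<n. elem_tensor (scal X (?c (h i)) (fst (h i))) (snd (h i)))
    = (\<Sum>i<n. - (elem_tensor (scal X (?c (h i)) (fst (h i))) (snd (h i))
        - ft_scale (?c (h i)) (elem_tensor (fst (h i)) (snd (h i)))))"
    by (simp add: sum_subtractf)
  also have "\<dots> \<in> bilinear_relations X Y"
    unfolding bilinear_relations_def
    by (intro ft.span_sum ft.span_neg ft.span_base) (use carr in blast)
  finally have "tensor_rep X Y F n (\<lambda>i. scal X (?c (h i)) (fst (h i))) (\<lambda>i. snd (h i))"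
    using carr by (simp add: tensor_rep_def)
  then show ?thesis by blast
qed

lemma tensor_rep_cost_nonneg:
  "tensor_rep X Y F n x y \<Longrightarrow> 0 \<le> (\<Sum>i<n. snorm X (x i) * snorm Y (y i))"
  by (intro sum_nonneg mult_nonneg_nonneg) (auto simp: tensor_rep_def)

lemma proj_seminorm_le:
  assumes "tensor_rep X Y F n x y"
  shows "proj_seminorm X Y F \<le> (\<Sum>i<n. snorm X (x i) * snorm Y (y i))"
  unfolding proj_seminorm_rep
  using assms tensor_rep_cost_nonneg by (intro cInf_lower bdd_belowI[of _ 0]) blast+

lemma proj_seminorm_greatest:
  assumes "Poly_Mapping.keys F \<subseteq> carr X \<times> carr Y"
    and "\<And>n x y. tensor_rep X Y F n x y \<Longrightarrow> c \<le> (\<Sum>i<n. snorm X (x i) * snorm Y (y i))"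
  shows "c \<le> proj_seminorm X Y F"
  unfolding proj_seminorm_rep
  using assms(2) ex_tensor_rep[OF assms(1)] by (intro cInf_greatest) blast+

lemma proj_seminorm_nonneg:
  "Poly_Mapping.keys F \<subseteq> carr X \<times> carr Y \<Longrightarrow> 0 \<le> proj_seminorm X Y F"
  by (rule proj_seminorm_greatest[OF _ tensor_rep_cost_nonneg])

text \<open>Concatenation of representations; their costs add as well, which gives the triangle
  inequality.\<close>

lemma tensor_rep_add:
  assumes "tensor_rep X Y F n x y" and "tensor_rep X Y G m x' y'"
  shows "tensor_rep X Y (F + G) (n + m) (\<lambda>i. if i < n then x i else x' (i - n))
    (\<lambda>i. if i < n then y i else y' (i - n))"
proof -
  have "(\<Sum>i<n+m. elem_tensor (if i < n then x i else x' (i - n)) (if i < n then y i else y' (i - n)))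
    = (\<Sum>i<n+m. if i < n then elem_tensor (x i) (y i) else elem_tensor (x' (i - n)) (y' (i - n)))"
    by (intro sum.cong) auto
  also have "\<dots> = (\<Sum>i<n. elem_tensor (x i) (y i)) + (\<Sum>i<m. elem_tensor (x' i) (y' i))"
    by (rule sum_append)
  finally have "F + G - (\<Sum>i<n+m. elem_tensor (if i < n then x i else x' (i - n)) (if i < n then y i else y' (i - n)))
    = (F - (\<Sum>i<n. elem_tensor (x i) (y i))) + (G - (\<Sum>i<m. elem_tensor (x' i) (y' i)))"
    by simp
  also have "\<dots> \<in> bilinear_relations X Y"
    using assms unfolding tensor_rep_def bilinear_relations_def by (intro ft.span_add) auto
  finally show ?thesis using assms by (auto simp: tensor_rep_def)
qed

lemma proj_seminorm_triangle:
  assumes F: "Poly_Mapping.keys F \<subseteq> carr X \<times> carr Y" and G: "Poly_Mapping.keys G \<subseteq> carr X \<times> carr Y"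
  shows "proj_seminorm X Y (F + G) \<le> proj_seminorm X Y F + proj_seminorm X Y G"
proof -
  \<comment> \<open>The two infima are treated one after the other, first over representations of
    \<open>F\<close>, then over those of \<open>G\<close>.\<close>
  have "proj_seminorm X Y (F + G) - proj_seminorm X Y G \<le> proj_seminorm X Y F"
  proof (rule proj_seminorm_greatest[OF F])
    fix n x y assume r: "tensor_rep X Y F n x y"
    have "proj_seminorm X Y (F + G) - (\<Sum>i<n. snorm X (x i) * snorm Y (y i)) \<le> proj_seminorm X Y G"
    proof (rule proj_seminorm_greatest[OF G])
      fix m x' y' assume r': "tensor_rep X Y G m x' y'"
      have "proj_seminorm X Y (F + G) \<le> (\<Sum>i<n+m. snorm X (if i < n then x i else x' (i - n))
          * snorm Y (if i < n then y i else y' (i - n)))"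
        by (rule proj_seminorm_le[OF tensor_rep_add[OF r r']])
      also have "\<dots> = (\<Sum>i<n+m. if i < n then snorm X (x i) * snorm Y (y i)
          else snorm X (x' (i - n)) * snorm Y (y' (i - n)))"
        by (intro sum.cong) auto
      also have "\<dots> = (\<Sum>i<n. snorm X (x i) * snorm Y (y i)) + (\<Sum>i<m. snorm X (x' i) * snorm Y (y' i))"
        by (rule sum_append)
      finally show "proj_seminorm X Y (F + G) - (\<Sum>i<n. snorm X (x i) * snorm Y (y i))
        \<le> (\<Sum>i<m. snorm X (x' i) * snorm Y (y' i))" by simp
    qed
    then show "proj_seminorm X Y (F + G) - proj_seminorm X Y G \<le> (\<Sum>i<n. snorm X (x i) * snorm Y (y i))"
      by simp
  qed
  then show ?thesis by simp
qed

lemma proj_tensor_carr: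
  "u \<in> carr (proj_tensor X Y) \<longleftrightarrow> (\<forall>n. Poly_Mapping.keys (u n) \<subseteq> carr X \<times> carr Y) \<and>
    (\<forall>e>0. \<exists>M. \<forall>m\<ge>M. \<forall>n\<ge>M. proj_seminorm X Y (u m - u n) < e)"
  by (simp add: proj_tensor_def completion_def alg_tensor_def)

lemma keys_diff_carr:
  assumes "Poly_Mapping.keys F \<subseteq> carr X \<times> carr Y" "Poly_Mapping.keys G \<subseteq> carr X \<times> carr Y"
  shows "Poly_Mapping.keys (F - G) \<subseteq> carr X \<times> carr Y"
  using keys_diff[of F G] assms by blast

text \<open>The completion defines its seminorm by \<open>lim\<close>, which means something only
  for a convergent sequence; the reverse triangle inequality makes the seminorms of a Cauchy
  sequence Cauchy.\<close>

lemma tendsto_proj_seminorm: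
  assumes "u \<in> carr (proj_tensor X Y)"
  shows "(\<lambda>n. proj_seminorm X Y (u n)) \<longlonglongrightarrow> snorm (proj_tensor X Y) u"
proof -
  have "Cauchy (\<lambda>n. proj_seminorm X Y (u n))"
  proof (rule metric_CauchyI)
    fix e :: real assume "0 < e"
    then obtain M where M: "\<And>m n. m \<ge> M \<Longrightarrow> n \<ge> M \<Longrightarrow> proj_seminorm X Y (u m - u n) < e"
      using assms unfolding proj_tensor_carr by blast
    have le: "proj_seminorm X Y (u m) - proj_seminorm X Y (u n) \<le> proj_seminorm X Y (u m - u n)" for m n
      using proj_seminorm_triangle[of "u m - u n" "u n"] assms keys_diff_carr[of "u m" "u n"]
      unfolding proj_tensor_carr by simp
    have "dist (proj_seminorm X Y (u m)) (proj_seminorm X Y (u n)) < e" if "m \<ge> M" "n \<ge> M" for m n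
      using le[of m n] le[of n m] M[OF that] M[OF that(2,1)] by (simp add: dist_real_def)
    then show "\<exists>M. \<forall>m\<ge>M. \<forall>n\<ge>M. dist (proj_seminorm X Y (u m)) (proj_seminorm X Y (u n)) < e"
      by blast
  qed
  then show ?thesis
    by (simp add: proj_tensor_def completion_def alg_tensor_def Cauchy_convergent_iff convergent_LIMSEQ_iff)
qed

end

section \<open>Bounded bilinear maps and their linearization\<close>

locale bounded_bilinear_form = seminormed_pair X Y + Z: seminormed_space Z
  for X :: "('x::ab_group_add, 'm) snspace_scheme" and Y :: "('y::ab_group_add, 'n) snspace_scheme"
    and Z :: "('z::ab_group_add, 'k) snspace_scheme" +
  fixes b :: "'x \<Rightarrow> 'y \<Rightarrow> 'z" and C :: real
  assumes closed: "x \<in> carr X \<Longrightarrow> y \<in> carr Y \<Longrightarrow> b x y \<in> carr Z"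
    and add_left: "x \<in> carr X \<Longrightarrow> x' \<in> carr X \<Longrightarrow> y \<in> carr Y \<Longrightarrow>
      snorm Z (b (x + x') y - b x y - b x' y) = 0"
    and add_right: "x \<in> carr X \<Longrightarrow> y \<in> carr Y \<Longrightarrow> y' \<in> carr Y \<Longrightarrow>
      snorm Z (b x (y + y') - b x y - b x y') = 0"
    and scal_left: "x \<in> carr X \<Longrightarrow> y \<in> carr Y \<Longrightarrow> snorm Z (b (scal X c x) y - scal Z c (b x y)) = 0"
    and scal_right: "x \<in> carr X \<Longrightarrow> y \<in> carr Y \<Longrightarrow> snorm Z (b x (scal Y c y) - scal Z c (b x y)) = 0"
    and C_nonneg: "0 \<le> C"
    and bounded: "x \<in> carr X \<Longrightarrow> y \<in> carr Y \<Longrightarrow> snorm Z (b x y) \<le> C * snorm X x * snorm Y y"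
begin

abbreviation lift :: "('x, 'y) ftensor \<Rightarrow> 'z" where
  "lift \<equiv> ft_lift (scal Z) b"

sublocale L: Vector_Spaces.linear ft_scale "scal Z" lift
  by (rule linear_ft_lift) unfold_locales

lemma lift_elem_tensor: "lift (elem_tensor x y) = b x y"
  by (rule ft_lift_elem_tensor) unfold_locales

lemma lift_closed:
  assumes "Poly_Mapping.keys F \<subseteq> carr X \<times> carr Y"
  shows "lift F \<in> carr Z"
  unfolding ft_lift_def using assms closed by (intro Z.sum_closed) auto

text \<open>As \<open>b\<close> is bilinear only up to elements of seminorm zero, the relations are
  sent to such elements and not to zero itself.\<close>

lemma lift_relations:
  assumes "F \<in> bilinear_relations X Y"
  shows "lift F \<in> {z \<in> carr Z. snorm Z z = 0}"
  using assms unfolding bilinear_relations_def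
proof (rule ft.span_induct)
  show "ft.subspace {F. lift F \<in> {z \<in> carr Z. snorm Z z = 0}}"
    using L.subspace_vimage[OF Z.subspace_null] by (simp add: vimage_def)
qed (elim UnE CollectE exE conjE,
    simp_all add: L.diff L.scale lift_elem_tensor closed add_left add_right scal_left scal_right)

text \<open>Every representation bounds the value by \<open>C\<close> times its cost, as the
  relation part has seminorm zero; the infimum over representations gives the claim. This is the
  boundedness half of the universal property of the projective tensor product.\<close>

lemma snorm_lift_le:
  assumes F: "Poly_Mapping.keys F \<subseteq> carr X \<times> carr Y"
  shows "snorm Z (lift F) \<le> C * proj_seminorm X Y F"
proof -
  have le: "snorm Z (lift F) \<le> C * (\<Sum>i<n. snorm X (x i) * snorm Y (y i))"
    if r: "tensor_rep X Y F n x y" for n x y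
  proof -
    let ?R = "F - (\<Sum>i<n. elem_tensor (x i) (y i))"
    have xy: "x i \<in> carr X" "y i \<in> carr Y" if "i < n" for i
      using r that by (auto simp: tensor_rep_def)
    have R: "lift ?R \<in> carr Z" "snorm Z (lift ?R) = 0"
      using lift_relations[of ?R] r by (auto simp: tensor_rep_def)
    have "lift F = lift ?R + (\<Sum>i<n. b (x i) (y i))"
      by (simp add: L.diff L.sum lift_elem_tensor)
    then have "snorm Z (lift F) \<le> snorm Z (lift ?R) + snorm Z (\<Sum>i<n. b (x i) (y i))"
      using R(1) xy closed by (auto intro!: Z.snorm_triangle Z.sum_closed)
    also have "\<dots> \<le> (\<Sum>i<n. snorm Z (b (x i) (y i)))"
      using R(2) xy closed by (auto intro!: Z.snorm_sum)
    also have "\<dots> \<le> (\<Sum>i<n. C * snorm X (x i) * snorm Y (y i))"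
      using xy by (intro sum_mono bounded) auto
    finally show ?thesis by (simp add: sum_distrib_left mult.assoc)
  qed
  show ?thesis
  \<comment> \<open>The infimum is reached after division by \<open>C\<close>, so the value zero is
    treated separately, through one arbitrary representation.\<close>
  proof (cases "C = 0")
    case True
    then show ?thesis using le ex_tensor_rep[OF F] by auto
  next
    case False
    then have "snorm Z (lift F) / C \<le> proj_seminorm X Y F"
      using C_nonneg le by (intro proj_seminorm_greatest[OF F]) (simp add: pos_divide_le_eq mult.commute)
    then show ?thesis using False C_nonneg by (simp add: pos_divide_le_eq mult.commute)
  qed
qed

lemma lift_Cauchy:
  assumes u: "u \<in> carr (proj_tensor X Y)" and e: "0 < e"
  shows "\<exists>M. \<forall>m\<ge>M. \<forall>n\<ge>M. snorm Z (lift (u m) - lift (u n)) < e"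
proof -
  \<comment> \<open>\<open>C + 1\<close> instead of \<open>C\<close> keeps the divisor positive when
    \<open>C\<close> is zero.\<close>
  have "0 < e / (C + 1)" using e C_nonneg by simp
  then obtain M where M: "\<And>m n. m \<ge> M \<Longrightarrow> n \<ge> M \<Longrightarrow> proj_seminorm X Y (u m - u n) < e / (C + 1)"
    using u unfolding proj_tensor_carr by blast
  have "snorm Z (lift (u m) - lift (u n)) < e" if "m \<ge> M" "n \<ge> M" for m n
  proof -
    have k: "Poly_Mapping.keys (u m - u n) \<subseteq> carr X \<times> carr Y"
      using u by (intro keys_diff_carr) (auto simp: proj_tensor_carr)
    have "snorm Z (lift (u m) - lift (u n)) \<le> C * proj_seminorm X Y (u m - u n)"
      using snorm_lift_le[OF k] by (simp add: L.diff)
    also have "\<dots> \<le> (C + 1) * proj_seminorm X Y (u m - u n)"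
      using proj_seminorm_nonneg[OF k] by (intro mult_right_mono) auto
    also have "\<dots> < e"
      using M[OF that] C_nonneg by (simp add: pos_less_divide_eq mult.commute)
    finally show ?thesis .
  qed
  then show ?thesis by blast
qed

end

section \<open>Scalar-valued forms and functionals on the projective tensor product\<close>

definition complex_space :: "complex snspace" where
  "complex_space = \<lparr>carr = UNIV, scal = (*), snorm = cmod\<rparr>"

lemma complex_space_simps [simp]:
  "carr complex_space = UNIV" "scal complex_space = (*)" "snorm complex_space = cmod"
  by (simp_all add: complex_space_def)

interpretation complex_space: seminormed_space complex_space
proof -
  interpret vector_space "(*) :: complex \<Rightarrow> complex \<Rightarrow> complex"
    by unfold_locales (simp_all add: algebra_simps)
  show "seminormed_space complex_space"
    by unfold_locales (simp_all add: algebra_simps norm_triangle_ineq norm_mult)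
qed

text \<open>The linear extension of \<open>b\<close>, extended by continuity to Cauchy sequences,
  which represent the points of the completed tensor product.\<close>

definition tensor_functional ::
  "('x \<Rightarrow> 'y \<Rightarrow> complex) \<Rightarrow> (nat \<Rightarrow> ('x, 'y) ftensor) \<Rightarrow> complex"
where
  "tensor_functional b u = lim (\<lambda>n. ft_lift (*) b (u n))"

locale bounded_scalar_form = bounded_bilinear_form X Y complex_space b C
  for X :: "('x::ab_group_add, 'm) snspace_scheme" and Y :: "('y::ab_group_add, 'n) snspace_scheme"
    and b C
begin

lemma tendsto_tensor_functional:
  assumes "u \<in> carr (proj_tensor X Y)"
  shows "(\<lambda>n. ft_lift (*) b (u n)) \<longlonglongrightarrow> tensor_functional b u"
proof -
  have "Cauchy (\<lambda>n. ft_lift (*) b (u n))"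
    using lift_Cauchy[OF assms] by (intro metric_CauchyI) (simp add: dist_norm)
  then show ?thesis
    by (simp add: tensor_functional_def Cauchy_convergent_iff convergent_LIMSEQ_iff)
qed

lemma tensor_functional_dual: "tensor_functional b \<in> dual_space (proj_tensor X Y)"
proof -
  have "tensor_functional b (u + v) = tensor_functional b u + tensor_functional b v"
    if "u \<in> carr (proj_tensor X Y)" "v \<in> carr (proj_tensor X Y)" for u v
    unfolding tensor_functional_def[of b "u + v"]
    using tendsto_add[OF that[THEN tendsto_tensor_functional]] L.add by (intro limI) simp
  moreover have "tensor_functional b (scal (proj_tensor X Y) c u) = c * tensor_functional b u"
    if "u \<in> carr (proj_tensor X Y)" for c u
    unfolding tensor_functional_def[of b "scal (proj_tensor X Y) c u"]
    using tendsto_mult_left[OF that[THEN tendsto_tensor_functional]] L.scale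
    by (intro limI) (simp add: proj_tensor_def completion_def alg_tensor_def)
  moreover have "cmod (tensor_functional b u) \<le> C * snorm (proj_tensor X Y) u"
    if u: "u \<in> carr (proj_tensor X Y)" for u
  proof (rule LIMSEQ_le)
    show "(\<lambda>n. cmod (ft_lift (*) b (u n))) \<longlonglongrightarrow> cmod (tensor_functional b u)"
      by (intro tendsto_norm tendsto_tensor_functional u)
    show "(\<lambda>n. C * proj_seminorm X Y (u n)) \<longlonglongrightarrow> C * snorm (proj_tensor X Y) u"
      by (intro tendsto_mult_left tendsto_proj_seminorm u)
    show "\<exists>M. \<forall>n\<ge>M. cmod (ft_lift (*) b (u n)) \<le> C * proj_seminorm X Y (u n)"
      using snorm_lift_le u by (auto simp: proj_tensor_carr)
  qed
  ultimately show ?thesis unfolding dual_space_def by blast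
qed

end

section \<open>Derivations pulled back along the product map\<close>

locale seminormed_algebra = bounded_bilinear_form A A A "mult A" 1
  for A :: "'a::ab_group_add snalgebra" +
  assumes complete: "(\<And>n. u n \<in> carr A) \<Longrightarrow>
    (\<And>e. 0 < e \<Longrightarrow> \<exists>M. \<forall>m\<ge>M. \<forall>n\<ge>M. snorm A (u m - u n) < e) \<Longrightarrow>
    \<exists>f\<in>carr A. (\<lambda>n. snorm A (u n - f)) \<longlonglongrightarrow> 0"
begin

text \<open>Boundedness of the product makes the images Cauchy, so completeness provides the limit
  that the choice in \<open>tensor_mult\<close> asks for.\<close>

lemma tensor_mult:
  assumes u: "u \<in> carr (proj_tensor A A)"
  shows "tensor_mult A u \<in> carr A"
    and "(\<lambda>n. snorm A (lift (u n) - tensor_mult A u)) \<longlonglongrightarrow> 0"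
proof -
  have "\<exists>f\<in>carr A. (\<lambda>n. snorm A (lift (u n) - f)) \<longlonglongrightarrow> 0"
    using lift_Cauchy[OF u] u by (intro complete lift_closed) (auto simp: proj_tensor_carr)
  then have "\<exists>f. f \<in> carr A \<and> (\<lambda>n. snorm A (lift (u n) - f)) \<longlonglongrightarrow> 0" by blast
  from someI_ex[OF this]
  show "tensor_mult A u \<in> carr A" "(\<lambda>n. snorm A (lift (u n) - tensor_mult A u)) \<longlonglongrightarrow> 0"
    unfolding tensor_mult_def by auto
qed

text \<open>The identity on elementary tensors extends by linearity to formal sums and by continuity
  to Cauchy sequences of them.\<close>

lemma pullback_derivation_inner:
  assumes D: "continuous_derivation A (regular_bimodule A) D"
  shows "wstar_approx_inner A (tensor_bimodule A) (\<lambda>f. D f \<circ> tensor_mult A)"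
proof -
  have D_right: "D f (x + y) = D f x + D f y" "D f (scal A c x) = c * D f x"
    if "f \<in> carr A" "x \<in> carr A" "y \<in> carr A" for c f x y
    using D that by (auto simp: continuous_derivation_def regular_bimodule_def dual_space_def)
  have D_left: "D (f + g) x = D f x + D g x" "D (scal A c f) x = c * D f x"
    if "f \<in> carr A" "g \<in> carr A" "x \<in> carr A" for c f g x
    using D that by (auto simp: continuous_derivation_def regular_bimodule_def)
  have D_mult: "D (mult A f g) x = D g (mult A x f) + D f (mult A g x)"
    if "f \<in> carr A" "g \<in> carr A" "x \<in> carr A" for f g x
    using D that
    by (auto simp: continuous_derivation_def regular_bimodule_def dual_lact_def dual_ract_def)
  have "\<exists>C. \<forall>f\<in>carr A. \<forall>x\<in>carr A. cmod (D f x) \<le> C * snorm A f * snorm A x"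
    using D by (simp add: continuous_derivation_def regular_bimodule_def)
  then obtain K0 where K0: "\<And>f x. f \<in> carr A \<Longrightarrow> x \<in> carr A \<Longrightarrow> cmod (D f x) \<le> K0 * snorm A f * snorm A x"
    by blast
  \<comment> \<open>The constant given by continuity may be negative if all products of seminorms
    vanish; the locale of forms asks for a nonnegative one.\<close>
  define K where "K = max K0 0"
  have K_nonneg: "0 \<le> K" by (simp add: K_def)
  have K: "cmod (D f x) \<le> K * snorm A f * snorm A x" if "f \<in> carr A" "x \<in> carr A" for f x
  proof -
    have "K0 * snorm A f * snorm A x \<le> K * snorm A f * snorm A x"
      using that by (intro mult_right_mono) (auto simp: K_def)
    then show ?thesis using K0[OF that] by linarith
  qed
  have D_diff: "D f (x - y) = D f x - D f y" "D (x - y) f = D x f - D y f"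
    if "f \<in> carr A" "x \<in> carr A" "y \<in> carr A" for f x y
    using D_right(1)[of f "x - y" y] D_left(1)[of "x - y" y f] that by auto
  \<comment> \<open>\<open>D\<close> respects the quotient in both arguments: by the bound
    \<open>K\<close>, an element of seminorm zero contributes nothing.\<close>
  have D_sub_null: "D f x = D f y" "D x f = D y f"
    if "f \<in> carr A" "x \<in> carr A" "y \<in> carr A" "snorm A (x - y) = 0" for f x y
    using K[of f "x - y"] K[of "x - y" f] D_diff[of f x y] that by auto
  \<comment> \<open>The product is bilinear only up to null elements, but by
    \<open>D_sub_null\<close> the values of \<open>D\<close> do not see the difference.\<close>
  have D_mult_left:
    "D (mult A (x + x') y) z = D (mult A x y) z + D (mult A x' y) z"
    "D (mult A (scal A c x) y) z = c * D (mult A x y) z"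
    "D z (mult A y (x + x')) = D z (mult A y x) + D z (mult A y x')"
    "D z (mult A y (scal A c x)) = c * D z (mult A y x)"
    if "x \<in> carr A" "x' \<in> carr A" "y \<in> carr A" "z \<in> carr A" for x x' y z c
    using D_sub_null(2)[of z "mult A (x + x') y" "mult A x y + mult A x' y"]
      D_sub_null(2)[of z "mult A (scal A c x) y" "scal A c (mult A x y)"]
      D_sub_null(1)[of z "mult A y (x + x')" "mult A y x + mult A y x'"]
      D_sub_null(1)[of z "mult A y (scal A c x)" "scal A c (mult A y x)"]
      that closed add_left[of x x' y] add_right[of y x x'] scal_left[of x y c] scal_right[of y x c]
    by (simp_all add: D_left[where g=0] D_left(1) D_right[where y=0] D_right(1) diff_diff_eq[symmetric])
  \<comment> \<open>The right tensor factor is fed to the derivation, and the left one is the point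
    of evaluation.\<close>
  have \<psi>: "bounded_scalar_form A A (\<lambda>g h. D h g) K"
  proof unfold_locales
    show "snorm complex_space (D y x) \<le> K * snorm A x * snorm A y" if "x \<in> carr A" "y \<in> carr A" for x y
      using K[OF that(2,1)] by (simp add: mult.commute mult.left_commute)
  qed (simp_all add: K_nonneg D_left[where g=0] D_left(1) D_right[where y=0] D_right(1))
  \<comment> \<open>This form gives the left action of \<open>f\<close> on the functional, since the
    dual action goes through the right action on tensors; \<open>\<psi>_lact\<close> gives the other
    one.\<close>
  have \<psi>_ract: "bounded_scalar_form A A (\<lambda>g h. D (mult A h f) g) (K * snorm A f)" if f: "f \<in> carr A" for f
  proof unfold_locales
    show "snorm complex_space (D (mult A y f) x) \<le> K * snorm A f * snorm A x * snorm A y"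
      if xy: "x \<in> carr A" "y \<in> carr A" for x y
    proof -
      have "cmod (D (mult A y f) x) \<le> K * snorm A (mult A y f) * snorm A x"
        using xy f closed by (intro K) auto
      also have "\<dots> \<le> K * (snorm A y * snorm A f) * snorm A x"
        using bounded[OF xy(2) f] xy K_nonneg by (intro mult_right_mono mult_left_mono) auto
      finally show ?thesis by (simp add: mult.commute mult.left_commute)
    qed
  qed (use f K_nonneg in \<open>simp_all add: closed D_mult_left(1) D_mult_left(2)[where x'=0]
        D_right[where y=0] D_right(1)\<close>)
  have \<psi>_lact: "bounded_scalar_form A A (\<lambda>g h. D h (mult A f g)) (K * snorm A f)" if f: "f \<in> carr A" for f
  proof unfold_locales
    show "snorm complex_space (D y (mult A f x)) \<le> K * snorm A f * snorm A x * snorm A y"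
      if xy: "x \<in> carr A" "y \<in> carr A" for x y
    proof -
      have "cmod (D y (mult A f x)) \<le> K * snorm A y * snorm A (mult A f x)"
        using xy f closed by (intro K) auto
      also have "\<dots> \<le> K * snorm A y * (snorm A f * snorm A x)"
        using bounded[OF f xy(1)] xy K_nonneg by (intro mult_left_mono) auto
      finally show ?thesis by (simp add: mult.commute mult.left_commute)
    qed
  qed (use f K_nonneg in \<open>simp_all add: closed D_mult_left(3) D_mult_left(4)[where x'=0]
        D_left[where g=0] D_left(1)\<close>)
  define \<psi> where "\<psi> = tensor_functional (\<lambda>g h. D h g)"
  have vs: "vector_space ((*) :: complex \<Rightarrow> complex \<Rightarrow> complex)"
    using complex_space.vector_space_axioms by simp
  have inner: "dual_lact (tensor_bimodule A) f \<psi> u - dual_ract (tensor_bimodule A) \<psi> f u = D f (tensor_mult A u)"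
    if f: "f \<in> carr A" and u: "u \<in> carr (proj_tensor A A)" for f u
  proof -
    have keys: "Poly_Mapping.keys (u n) \<subseteq> carr A \<times> carr A" for n
      using u by (auto simp: proj_tensor_carr)
    have D_sum: "D f (sum w I) = (\<Sum>i\<in>I. D f (w i))" if "finite I" "\<And>i. i \<in> I \<Longrightarrow> w i \<in> carr A"
      for w and I :: "('a \<times> 'a) set"
      using that
    proof (induction I rule: finite_induct)
      case empty
      then show ?case using D_right(1)[of f 0 0] f by simp
    next
      case (insert i I)
      then show ?case using D_right(1)[of f "w i" "sum w I"] f by (simp add: X.sum_closed)
    qed
    \<comment> \<open>On formal sums the commutator with \<open>f\<close> reduces, term by term, to
      the derivation identity for the product of \<open>h\<close> and \<open>f\<close>, evaluated at
      \<open>g\<close>.\<close>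
    have diff: "ft_lift (*) (\<lambda>g h. D (mult A h f) g) (u n) - ft_lift (*) (\<lambda>g h. D h (mult A f g)) (u n)
        = D f (lift (u n))" for n
    proof -
      have "D f (lift (u n)) = (\<Sum>k\<in>Poly_Mapping.keys (u n).
          D f (scal A (Poly_Mapping.lookup (u n) k) (mult A (fst k) (snd k))))"
        unfolding ft_lift_def case_prod_unfold prod.collapse using keys[of n] closed
        by (intro D_sum) auto
      also have "\<dots> = (\<Sum>k\<in>Poly_Mapping.keys (u n).
          Poly_Mapping.lookup (u n) k * (D (mult A (snd k) f) (fst k) - D (snd k) (mult A f (fst k))))"
      proof (intro sum.cong refl)
        fix k assume "k \<in> Poly_Mapping.keys (u n)"
        then have k: "fst k \<in> carr A" "snd k \<in> carr A" using keys[of n] by auto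
        show "D f (scal A (Poly_Mapping.lookup (u n) k) (mult A (fst k) (snd k)))
          = Poly_Mapping.lookup (u n) k * (D (mult A (snd k) f) (fst k) - D (snd k) (mult A f (fst k)))"
          using k f closed D_mult[OF k(2) f k(1)] by (simp add: D_right(2)[where y=0])
      qed
      finally show ?thesis
        by (simp add: ft_lift_def case_prod_unfold right_diff_distrib sum_subtractf)
    qed
    have ract: "dual_lact (tensor_bimodule A) f \<psi> u = tensor_functional (\<lambda>g h. D (mult A h f) g) u"
      by (simp add: dual_lact_def tensor_bimodule_def \<psi>_def tensor_functional_def
          ft_lift_elem_tensor_compose[OF vs])
    have lact: "dual_ract (tensor_bimodule A) \<psi> f u = tensor_functional (\<lambda>g h. D h (mult A f g)) u"
      by (simp add: dual_ract_def tensor_bimodule_def \<psi>_def tensor_functional_def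
          ft_lift_elem_tensor_compose[OF vs])
    \<comment> \<open>The same sequence gets two limits: the commutator at \<open>u\<close> and, by
      continuity of \<open>D f\<close>, the value at the product. Uniqueness identifies
      them.\<close>
    have lim1: "(\<lambda>n. D f (lift (u n))) \<longlonglongrightarrow>
        dual_lact (tensor_bimodule A) f \<psi> u - dual_ract (tensor_bimodule A) \<psi> f u"
      unfolding ract lact diff[symmetric]
      by (intro tendsto_diff bounded_scalar_form.tendsto_tensor_functional[OF \<psi>_ract[OF f] u]
          bounded_scalar_form.tendsto_tensor_functional[OF \<psi>_lact[OF f] u])
    have "(\<lambda>n. D f (lift (u n)) - D f (tensor_mult A u)) \<longlonglongrightarrow> 0"
    proof (rule Lim_null_comparison)
      have "cmod (D f (lift (u n)) - D f (tensor_mult A u))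
          \<le> K * snorm A f * snorm A (lift (u n) - tensor_mult A u)" for n
        using K[of f "lift (u n) - tensor_mult A u"] D_diff(1)[of f "lift (u n)" "tensor_mult A u"]
          f lift_closed[OF keys] tensor_mult(1)[OF u] by simp
      then show "\<forall>\<^sub>F n in sequentially. cmod (D f (lift (u n)) - D f (tensor_mult A u))
          \<le> K * snorm A f * snorm A (lift (u n) - tensor_mult A u)" by simp
      show "(\<lambda>n. K * snorm A f * snorm A (lift (u n) - tensor_mult A u)) \<longlonglongrightarrow> 0"
        by (intro tendsto_mult_right_zero tensor_mult(2) u)
    qed
    then have "(\<lambda>n. D f (lift (u n))) \<longlonglongrightarrow> D f (tensor_mult A u)"
      by (simp add: LIM_zero_iff)
    with lim1 show ?thesis by (rule LIMSEQ_unique)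
  qed
  have "\<psi> \<in> dual_space (tensor_bimodule A)"
    using bounded_scalar_form.tensor_functional_dual[OF \<psi>]
    by (simp add: \<psi>_def dual_space_def tensor_bimodule_def)
  \<comment> \<open>The principal filter at \<open>\<psi>\<close> plays the role of a constant
    net.\<close>
  moreover have "((\<lambda>\<phi>. dual_lact (tensor_bimodule A) f \<phi> u - dual_ract (tensor_bimodule A) \<phi> f u)
      \<longlongrightarrow> (D f \<circ> tensor_mult A) u) (principal {\<psi>})"
    if "f \<in> carr A" "u \<in> carr (tensor_bimodule A)" for f u
    using tendsto_principal_singleton[of "\<lambda>\<phi>. dual_lact (tensor_bimodule A) f \<phi> u
      - dual_ract (tensor_bimodule A) \<phi> f u" \<psi>] inner[of f u] that
    by (simp add: tensor_bimodule_def)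
  ultimately show ?thesis
    unfolding wstar_approx_inner_def
    by (intro exI[of _ "principal {\<psi>}"]) (simp add: eventually_principal principal_eq_bot_iff)
qed

end

section \<open>Convolution is bilinear almost everywhere\<close>


definition dyadic :: "nat \<Rightarrow> ennreal" where
  "dyadic n = ennreal (2 powr real_of_int (int_decode n))"

lemma dyadic_pos: "0 < dyadic n"
  by (simp add: dyadic_def)

text \<open>\<open>dyadic\<close> runs through all integer powers of two. One term suffices: the
  largest power strictly below a positive \<open>r\<close> is at least half of
  \<open>r\<close>.\<close>

lemma le_suminf_dyadic:
  assumes "r < top"
  shows "r \<le> 2 * suminf (\<lambda>n. dyadic n * indicator {dyadic n<..} r)"
proof -
  obtain q where q: "r = ennreal q" "q \<ge> 0" using assms by (cases r) auto
  show ?thesis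
  proof (cases "q = 0")
    case True then show ?thesis using q by simp
  next
    case False
    then have qp: "q > 0" using q by simp
    \<comment> \<open>The ceiling minus one rather than the floor: the power must lie strictly below
      \<open>q\<close> even if \<open>q\<close> is itself a power of two.\<close>
    define k where "k = \<lceil>log 2 q\<rceil> - 1"
    have k1: "2 powr k < q"
    proof -
      have "real_of_int k < log 2 q" unfolding k_def by linarith
      then have "2 powr k < 2 powr (log 2 q)" by simp
      then show ?thesis using qp by simp
    qed
    have k2: "q \<le> 2 * 2 powr k"
    proof -
      have "log 2 q \<le> 1 + real_of_int k" unfolding k_def by linarith
      then have "2 powr (log 2 q) \<le> 2 powr (1 + real_of_int k)" by simp
      then show ?thesis using qp by (simp add: powr_add)
    qed
    let ?n = "int_encode k"
    have d: "dyadic ?n = ennreal (2 powr k)" by (simp add: dyadic_def)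
    have lt: "dyadic ?n < r" using k1 q d by (simp add: ennreal_less_iff)
    have "r \<le> 2 * dyadic ?n"
      using k2 q d by (metis ennreal_leI ennreal_mult' ennreal_numeral zero_le_numeral)
    also have "dyadic ?n = (\<Sum>n\<in>{?n}. dyadic n * indicator {dyadic n<..} r)"
      using lt by simp
    also have "2 * \<dots> \<le> 2 * suminf (\<lambda>n. dyadic n * indicator {dyadic n<..} r)"
      by (intro mult_left_mono sum_le_suminf summableI) auto
    finally show ?thesis .
  qed
qed

text \<open>Induction on the largest exponent \<open>b\<close>: the others contribute at most
  \<open>2 powr b\<close>, and doubling gives \<open>2 powr (b + 1)\<close>.\<close>

lemma sum_two_powr_le:
  fixes A :: "int set"
  assumes "finite A" and "\<And>a. a \<in> A \<Longrightarrow> a < m"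
  shows "(\<Sum>a\<in>A. 2 powr real_of_int a) \<le> 2 powr real_of_int m"
  using assms
proof (induction A arbitrary: m rule: finite_linorder_max_induct)
  case empty
  then show ?case by simp
next
  case (insert b A)
  have "(\<Sum>a\<in>A. 2 powr real_of_int a) \<le> 2 powr real_of_int b"
    using insert by blast
  then have "(\<Sum>a\<in>insert b A. 2 powr real_of_int a) \<le> 2 powr real_of_int (b + 1)"
    using insert.hyps by (subst sum.insert) (auto simp: powr_add)
  also have "\<dots> \<le> 2 powr real_of_int m"
    using insert.prems[of b] by (intro powr_mono) auto
  finally show ?case .
qed

text \<open>A geometric sum is controlled by its last term: the powers below \<open>r\<close> add up
  to at most twice the largest of them. With \<open>le_suminf_dyadic\<close>, a finite
  \<open>r\<close> and the sum of its layers agree up to a factor of two on either side.\<close>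

lemma sum_dyadic_le:
  assumes "finite T"
  shows "(\<Sum>n\<in>T. dyadic n * indicator {dyadic n<..} r) \<le> 2 * r"
proof (cases r)
  case top
  then show ?thesis by (simp add: ennreal_mult_top)
next
  case (real q)
  define A where "A = {k \<in> int_decode ` T. 2 powr real_of_int k < q}"
  have fA: "finite A" using assms by (simp add: A_def)
  have A_eq: "A = int_decode ` {n\<in>T. dyadic n < r}"
    using real by (auto simp: A_def dyadic_def ennreal_less_iff)
  have "(\<Sum>n\<in>T. dyadic n * indicator {dyadic n<..} r) = (\<Sum>n\<in>{n\<in>T. dyadic n < r}. dyadic n)"
    using assms by (intro sum.mono_neutral_cong_right) auto
  also have "\<dots> = (\<Sum>k\<in>A. ennreal (2 powr real_of_int k))"
    unfolding A_eq by (subst sum.reindex) (auto simp: dyadic_def intro: inj_on_subset[OF inj_int_decode])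
  also have "\<dots> = ennreal (\<Sum>k\<in>A. 2 powr real_of_int k)"
    by (intro sum_ennreal) auto
  also have "\<dots> \<le> ennreal (2 * q)"
  proof (cases "A = {}")
    case True
    then show ?thesis by simp
  next
    case False
    have "Max A \<in> A" using fA False by simp
    then have M: "2 powr real_of_int (Max A) < q" by (simp add: A_def)
    have "(\<Sum>k\<in>A. 2 powr real_of_int k) \<le> 2 powr real_of_int (Max A + 1)"
      using fA by (intro sum_two_powr_le) (auto simp: less_add_one zle_add1_eq_le)
    also have "\<dots> \<le> 2 * q" using M by (simp add: powr_add)
    finally show ?thesis by (rule ennreal_leI)
  qed
  also have "\<dots> = 2 * r" using real by (simp add: ennreal_mult')
  finally show ?thesis .
qed

text \<open>Suprema are handled one index at a time, as the values of \<open>K\<close> can be chosen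
  independently. The summand \<open>c\<close> collects terms already treated, which makes the
  induction go through.\<close>

lemma sum_SUP_le_ennreal:
  fixes m :: "'i \<Rightarrow> 'k \<Rightarrow> ennreal"
  assumes "finite I" and "\<And>i. i \<in> I \<Longrightarrow> S i \<noteq> {}"
    and "\<And>K. (\<And>i. i \<in> I \<Longrightarrow> K i \<in> S i) \<Longrightarrow> c + (\<Sum>i\<in>I. w i * m i (K i)) \<le> B"
  shows "c + (\<Sum>i\<in>I. w i * (SUP k\<in>S i. m i k)) \<le> B"
  using assms
proof (induction I arbitrary: c rule: finite_induct)
  case empty
  then show ?case by simp
next
  case (insert j I)
  have step: "(c + (\<Sum>i\<in>I. w i * (SUP k\<in>S i. m i k))) + w j * m j k \<le> B" if k: "k \<in> S j" for k
  proof -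
    have "(c + w j * m j k) + (\<Sum>i\<in>I. w i * (SUP k\<in>S i. m i k)) \<le> B"
    proof (rule insert.IH)
      fix K assume K: "\<And>i. i \<in> I \<Longrightarrow> K i \<in> S i"
      have "c + (\<Sum>i\<in>insert j I. w i * m i ((K(j := k)) i)) \<le> B"
        using K k by (intro insert.prems) auto
      moreover have "(\<Sum>i\<in>I. w i * m i ((K(j := k)) i)) = (\<Sum>i\<in>I. w i * m i (K i))"
        using insert.hyps by (intro sum.cong) auto
      ultimately show "(c + w j * m j k) + (\<Sum>i\<in>I. w i * m i (K i)) \<le> B"
        using insert.hyps by (simp add: add.assoc)
    qed (use insert.prems in auto)
    then show ?thesis by (simp add: add.assoc add.commute add.left_commute)
  qed
  have "c + (\<Sum>i\<in>insert j I. w i * (SUP k\<in>S i. m i k))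
      = (c + (\<Sum>i\<in>I. w i * (SUP k\<in>S i. m i k))) + (SUP k\<in>S j. w j * m j k)"
    using insert.hyps by (simp add: SUP_mult_left_ennreal add.assoc add.commute add.left_commute)
  also have "\<dots> = (SUP k\<in>S j. (c + (\<Sum>i\<in>I. w i * (SUP k\<in>S i. m i k))) + w j * m j k)"
    using insert.prems(1)[of j] by (intro ennreal_SUP_add_right) auto
  also have "\<dots> \<le> B" by (intro SUP_least step)
  finally show ?case .
qed

section \<open>Haar measure of sections of open sets\<close>

context
  fixes \<mu> :: "'g::{topological_group_add, t2_space} measure"
  assumes haar: "left_haar_measure \<mu>"
begin

lemma haar_sets: "sets \<mu> = sets borel"
  using haar unfolding left_haar_measure_def by (elim conjE)

lemma haar_space: "space \<mu> = UNIV"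
  using sets_eq_imp_space_eq[OF haar_sets] by simp

lemma haar_compact:
  assumes "compact K"
  shows "emeasure \<mu> K < \<infinity>"
proof -
  have "\<forall>K. compact K \<longrightarrow> emeasure \<mu> K < \<infinity>"
    using haar unfolding left_haar_measure_def by (elim conjE)
  with assms show ?thesis by blast
qed

lemma haar_outer:
  assumes "A \<in> sets borel"
  shows "emeasure \<mu> A = (INF U\<in>{U. open U \<and> A \<subseteq> U}. emeasure \<mu> U)"
proof -
  have "\<forall>A\<in>sets borel. emeasure \<mu> A = (INF U\<in>{U. open U \<and> A \<subseteq> U}. emeasure \<mu> U)"
    using haar unfolding left_haar_measure_def by (elim conjE)
  from bspec[OF this assms] show ?thesis .
qed

lemma haar_inner:
  assumes "open U"
  shows "emeasure \<mu> U = (SUP K\<in>{K. compact K \<and> K \<subseteq> U}. emeasure \<mu> K)"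
proof -
  have "\<forall>U. open U \<longrightarrow> emeasure \<mu> U = (SUP K\<in>{K. compact K \<and> K \<subseteq> U}. emeasure \<mu> K)"
    using haar unfolding left_haar_measure_def by (elim conjE)
  from mp[OF spec[OF this] assms] show ?thesis .
qed

text \<open>Invariance is given for images; the preimage under a left translation is the image under
  the inverse one.\<close>

lemma haar_translate:
  assumes "A \<in> sets borel"
  shows "emeasure \<mu> {x. - y + x \<in> A} = emeasure \<mu> A"
proof -
  have "{x. - y + x \<in> A} = (\<lambda>x. y + x) ` A"
  proof (intro equalityI subsetI)
    fix x assume "x \<in> {x. - y + x \<in> A}"
    then show "x \<in> (\<lambda>x. y + x) ` A"
      by (intro image_eqI[of _ _ "- y + x"]) (simp_all add: add.assoc[symmetric])
  qed (auto simp: add.assoc[symmetric])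
  moreover have "\<forall>x. \<forall>A\<in>sets borel. emeasure \<mu> ((\<lambda>y. x + y) ` A) = emeasure \<mu> A"
    using haar unfolding left_haar_measure_def by (elim conjE)
  ultimately show ?thesis using assms by simp
qed

lemma open_section:
  assumes "open U" "open V"
  shows "open {y\<in>V. - y + x \<in> (U :: 'g set)}"
proof -
  have "open ((\<lambda>y. - y + x) -` U)"
    using assms by (intro open_vimage continuous_intros) auto
  then have "open (V \<inter> ((\<lambda>y. - y + x) -` U))" using assms by auto
  moreover have "V \<inter> ((\<lambda>y. - y + x) -` U) = {y\<in>V. - y + x \<in> U}" by auto
  ultimately show ?thesis by simp
qed

text \<open>Inner regularity gives a compact \<open>C\<close> in the section over \<open>x\<close>,
  and the tube lemma keeps \<open>C\<close> inside the sections over a neighbourhood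
  \<open>A\<close> of \<open>x\<close>.\<close>

lemma section_rectangle:
  assumes U: "open U" and V: "open V"
    and t: "t < emeasure \<mu> {y\<in>V. - y + x \<in> U}"
  obtains A C where "open A" "x \<in> A" "compact C" "t < emeasure \<mu> C"
    "\<forall>x'\<in>A. \<forall>y\<in>C. y \<in> V \<and> - y + x' \<in> U"
proof -
  obtain C where C: "compact C" "C \<subseteq> {y\<in>V. - y + x \<in> U}" "t < emeasure \<mu> C"
    using t unfolding haar_inner[OF open_section[OF U V]] by (auto simp: less_SUP_iff)
  have op: "open ((\<lambda>p. - snd p + fst p) -` U :: ('g \<times> 'g) set)"
    using U by (intro open_vimage continuous_intros) auto
  have sub: "{x} \<times> C \<subseteq> (\<lambda>p. - snd p + fst p) -` U" using C by auto
  obtain A where A: "x \<in> A" "open A" "A \<times> C \<subseteq> (\<lambda>p. - snd p + fst p) -` U"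
    using Elementary_Topology.tube_lemma[OF C(1) op sub] by (elim exE conjE)
  show thesis
  proof (rule that[OF A(2,1) C(1,3)], intro ballI)
    fix x' y assume "x' \<in> A" "y \<in> C"
    with A(3) have "(x', y) \<in> (\<lambda>p. - snd p + fst p) -` U" by blast
    with \<open>y \<in> C\<close> C(2) show "y \<in> V \<and> - y + x' \<in> U" by auto
  qed
qed

text \<open>Finitely many rectangles cover the compact sets \<open>K i\<close>; their union
  \<open>W\<close> consists of pairs with \<open>y\<close> in \<open>V\<close> and
  \<open>- y + x\<close> in \<open>U\<close>, and is measurable for the product. Tonelli for
  \<open>W\<close> compares its vertical sections, which are large over \<open>K i\<close>, with the
  horizontal ones, which lie in translates of \<open>U\<close>. The hypothesis on \<open>t\<close>
  says that the levels below a given height sum to at most twice this height.\<close>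

lemma sum_compact_level_le:
  fixes t :: "'i \<Rightarrow> ennreal"
  assumes U: "open U" and V: "open V" and V_fin: "emeasure \<mu> V < \<infinity>" and "finite I"
    and K: "\<And>i. i \<in> I \<Longrightarrow> compact (K i)"
      "\<And>i. i \<in> I \<Longrightarrow> K i \<subseteq> {x. t i < emeasure \<mu> {y\<in>V. - y + x \<in> U}}"
    and t: "\<And>a. (\<Sum>i\<in>I. t i * indicator {t i<..} a) \<le> 2 * a"
  shows "(\<Sum>i\<in>I. t i * emeasure \<mu> (K i)) \<le> 2 * (emeasure \<mu> V * emeasure \<mu> U)"
proof -
  define rect where "rect r A C \<longleftrightarrow> open A \<and> compact C \<and> r < emeasure \<mu> C \<and>
    (\<forall>x\<in>A. \<forall>y\<in>C. y \<in> V \<and> - y + x \<in> U)" for r A C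
  have "\<exists>A C. x \<in> A \<and> rect (t i) A C" if "i \<in> I" "x \<in> K i" for i x
  proof -
    have lt: "t i < emeasure \<mu> {y\<in>V. - y + x \<in> U}" using that K(2) by blast
    obtain A C where "open A" "x \<in> A" "compact C" "t i < emeasure \<mu> C"
      "\<forall>x'\<in>A. \<forall>y\<in>C. y \<in> V \<and> - y + x' \<in> U"
      by (rule section_rectangle[OF U V lt])
    then show ?thesis unfolding rect_def by (intro exI[of _ A] exI[of _ C] conjI)
  qed
  then obtain A C where AC: "\<And>i x. i \<in> I \<Longrightarrow> x \<in> K i \<Longrightarrow> x \<in> A i x \<and> rect (t i) (A i x) (C i x)"
    by metis
  have "\<exists>J. J \<subseteq> K i \<and> finite J \<and> K i \<subseteq> (\<Union>x\<in>J. A i x)" if i: "i \<in> I" for i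
  proof -
    have op: "open (A i x)" if "x \<in> K i" for x
      using AC[OF i that] by (simp add: rect_def)
    have cov: "K i \<subseteq> (\<Union>x\<in>K i. A i x)" using AC[OF i] by blast
    show ?thesis by (rule compactE_image[OF K(1)[OF i] op cov]) blast+
  qed
  then obtain J where J: "\<And>i. i \<in> I \<Longrightarrow> J i \<subseteq> K i" "\<And>i. i \<in> I \<Longrightarrow> finite (J i)"
    "\<And>i. i \<in> I \<Longrightarrow> K i \<subseteq> (\<Union>x\<in>J i. A i x)"
    by metis
  have R: "rect (t i) (A i x) (C i x)" if "i \<in> I" "x \<in> J i" for i x
    using that J(1) AC by blast
  \<comment> \<open>Cutting the rectangles down to the compact set \<open>L\<close> confines the
    first coordinate to a set of finite measure.\<close>
  define L where "L = (\<Union>i\<in>I. K i)"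
  define W where "W = (\<Union>i\<in>I. \<Union>x\<in>J i. (A i x \<inter> L) \<times> C i x)"
  have L: "compact L" unfolding L_def using \<open>finite I\<close> K(1) by (intro compact_UN) auto
  have L_sets: "L \<in> sets borel" using L by (intro borel_closed compact_imp_closed)
  \<comment> \<open>Tonelli needs sigma-finite factors; both restrictions of \<open>\<mu>\<close>
    are even finite.\<close>
  define M1 where "M1 = density \<mu> (indicator L)"
  define M2 where "M2 = density \<mu> (indicator V)"
  have sets12: "sets M1 = sets borel" "sets M2 = sets borel"
    by (simp_all add: M1_def M2_def haar_sets)
  have em1: "emeasure M1 X = emeasure \<mu> (L \<inter> X)" if "X \<in> sets borel" for X
    unfolding M1_def using that L_sets by (intro emeasure_restricted) (auto simp: haar_sets)
  have em2: "emeasure M2 X = emeasure \<mu> (V \<inter> X)" if "X \<in> sets borel" for X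
    unfolding M2_def using that V by (intro emeasure_restricted) (auto simp: haar_sets)
  have space12: "space M1 = UNIV" "space M2 = UNIV"
    by (simp_all add: M1_def M2_def haar_space)
  interpret M1: finite_measure M1
    using haar_compact[OF L] em1[of UNIV] by (intro finite_measureI) (auto simp: space12)
  interpret M2: finite_measure M2
    using V_fin em2[of UNIV] by (intro finite_measureI) (auto simp: space12)
  interpret P: pair_sigma_finite M1 M2 by unfold_locales
  have W_sets: "W \<in> sets (M1 \<Otimes>\<^sub>M M2)"
    unfolding W_def
  proof (intro sets.finite_UN \<open>finite I\<close>)
    fix i x assume "i \<in> I" "x \<in> J i"
    from R[OF this] have "open (A i x)" "compact (C i x)" by (simp_all add: rect_def)
    then show "(A i x \<inter> L) \<times> C i x \<in> sets (M1 \<Otimes>\<^sub>M M2)"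
      using L_sets by (intro pair_measureI) (auto simp: sets12 intro: borel_closed compact_imp_closed)
  qed (rule J(2))
  have W_sub: "y \<in> V \<and> - y + x \<in> U \<and> x \<in> L" if "(x, y) \<in> W" for x y
    using that R by (auto simp: W_def rect_def)
  have sec1: "{y. (x, y) \<in> W} \<in> sets borel" for x
    using sets_Pair1[OF W_sets, of x] by (simp add: sets12 vimage_def)
  have sec2: "{x. (x, y) \<in> W} \<in> sets borel" for y
    using sets_Pair2[OF W_sets, of y] by (simp add: sets12 vimage_def)
  have meas: "(\<lambda>x. emeasure M2 (Pair x -` W)) \<in> borel_measurable \<mu>"
    using M2.measurable_emeasure_Pair[OF W_sets] by (simp add: measurable_def sets12 haar_sets space12 haar_space)
  \<comment> \<open>Over a point of \<open>K i\<close> the section of \<open>W\<close> contains some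
    \<open>C i z\<close>, whose measure exceeds \<open>t i\<close>.\<close>
  have level: "t i * indicator (K i) x
      \<le> t i * indicator {t i<..} (emeasure M2 (Pair x -` W)) * indicator L x"
    if i: "i \<in> I" for i x
  proof (cases "x \<in> K i")
    case True
    then obtain z where z: "z \<in> J i" "x \<in> A i z" using J(3)[OF i] by blast
    have xL: "x \<in> L" using True i by (auto simp: L_def)
    have "t i < emeasure \<mu> (C i z)" using R[OF i z(1)] by (simp add: rect_def)
    also have "\<dots> \<le> emeasure \<mu> (V \<inter> {y. (x, y) \<in> W})"
    proof (rule emeasure_mono)
      show "C i z \<subseteq> V \<inter> {y. (x, y) \<in> W}"
        using z xL i R[OF i z(1)] by (auto simp: W_def rect_def)
      show "V \<inter> {y. (x, y) \<in> W} \<in> sets \<mu>" using sec1 V by (auto simp: haar_sets)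
    qed
    also have "\<dots> = emeasure M2 (Pair x -` W)" using em2[OF sec1] by (simp add: vimage_def)
    finally show ?thesis using xL True by simp
  qed simp
  have "(\<Sum>i\<in>I. t i * emeasure \<mu> (K i)) = (\<integral>\<^sup>+x. (\<Sum>i\<in>I. t i * indicator (K i) x) \<partial>\<mu>)"
  proof -
    have "K i \<in> sets \<mu>" if "i \<in> I" for i
      using K(1)[OF that] by (auto simp: haar_sets intro: borel_closed compact_imp_closed)
    then show ?thesis by (subst nn_integral_sum) (auto simp: nn_integral_cmult_indicator)
  qed
  also have "\<dots> \<le> (\<integral>\<^sup>+x. 2 * emeasure M2 (Pair x -` W) * indicator L x \<partial>\<mu>)"
  proof (rule nn_integral_mono)
    fix x
    have "(\<Sum>i\<in>I. t i * indicator (K i) x)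
      \<le> (\<Sum>i\<in>I. t i * indicator {t i<..} (emeasure M2 (Pair x -` W)) * indicator L x)"
      by (intro sum_mono level)
    also have "\<dots> = (\<Sum>i\<in>I. t i * indicator {t i<..} (emeasure M2 (Pair x -` W))) * indicator L x"
      by (simp add: sum_distrib_right)
    also have "\<dots> \<le> 2 * emeasure M2 (Pair x -` W) * indicator L x"
      by (intro mult_right_mono t) simp
    finally show "(\<Sum>i\<in>I. t i * indicator (K i) x) \<le> \<dots>" .
  qed
  also have "\<dots> = 2 * (\<integral>\<^sup>+x. emeasure M2 (Pair x -` W) \<partial>M1)"
  proof -
    have [measurable]: "L \<in> sets \<mu>" using L_sets by (simp add: haar_sets)
    note meas[measurable]
    show ?thesis
      unfolding M1_def by (subst nn_integral_density) (auto simp: nn_integral_cmult[symmetric] ac_simps)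
  qed
  \<comment> \<open>Both iterated integrals equal the product measure of \<open>W\<close>.\<close>
  also have "(\<integral>\<^sup>+x. emeasure M2 (Pair x -` W) \<partial>M1)
      = (\<integral>\<^sup>+y. emeasure M1 ((\<lambda>x. (x, y)) -` W) \<partial>M2)"
    using M2.emeasure_pair_measure_alt[OF W_sets] P.emeasure_pair_measure_alt2[OF W_sets] by simp
  also have "\<dots> \<le> (\<integral>\<^sup>+y. emeasure \<mu> U \<partial>M2)"
  proof (rule nn_integral_mono)
    fix y
    have "emeasure M1 ((\<lambda>x. (x, y)) -` W) = emeasure \<mu> (L \<inter> {x. (x, y) \<in> W})"
      using em1[OF sec2] by (simp add: vimage_def)
    also have "\<dots> \<le> emeasure \<mu> {x. - y + x \<in> U}"
    proof (rule emeasure_mono)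
      have "open ((\<lambda>x. - y + x) -` U)" using U by (intro open_vimage continuous_intros) auto
      then show "{x. - y + x \<in> U} \<in> sets \<mu>" by (simp add: haar_sets vimage_def)
    qed (use W_sub in auto)
    also have "\<dots> = emeasure \<mu> U" using U by (intro haar_translate) auto
    finally show "emeasure M1 ((\<lambda>x. (x, y)) -` W) \<le> emeasure \<mu> U" .
  qed
  also have "\<dots> = emeasure \<mu> V * emeasure \<mu> U"
    using em2[of UNIV] by (simp add: space12 mult.commute)
  finally show ?thesis by (simp add: mult_left_mono)
qed

text \<open>Lower semicontinuity: near each point of the superlevel set,
  \<open>section_rectangle\<close> puts one fixed compact set of measure above \<open>t\<close> into
  all sections.\<close>

lemma borel_measurable_section:
  assumes "open U" "open V"
  shows "(\<lambda>x. emeasure \<mu> {y\<in>V. - y + x \<in> U}) \<in> borel_measurable \<mu>"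
    and "open {x. t < emeasure \<mu> {y\<in>V. - y + x \<in> U}}"
proof -
  show op: "open {x. t < emeasure \<mu> {y\<in>V. - y + x \<in> U}}" for t
  proof (subst open_subopen, rule ballI)
    fix x assume "x \<in> {x. t < emeasure \<mu> {y\<in>V. - y + x \<in> U}}"
    then have x: "t < emeasure \<mu> {y\<in>V. - y + x \<in> U}" by simp
    obtain A C where AC: "open A" "x \<in> A" "compact C" "t < emeasure \<mu> C"
      "\<forall>x'\<in>A. \<forall>y\<in>C. y \<in> V \<and> - y + x' \<in> U"
      by (rule section_rectangle[OF assms x])
    have "t < emeasure \<mu> {y\<in>V. - y + x' \<in> U}" if "x' \<in> A" for x'
      using AC(4) bspec[OF AC(5) that] open_section[OF assms, of x']
      by (elim less_le_trans, intro emeasure_mono) (auto simp: haar_sets)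
    then show "\<exists>A. open A \<and> x \<in> A \<and> A \<subseteq> {x. t < emeasure \<mu> {y\<in>V. - y + x \<in> U}}"
      using AC by blast
  qed
  show "(\<lambda>x. emeasure \<mu> {y\<in>V. - y + x \<in> U}) \<in> borel_measurable \<mu>"
    using op by (intro borel_measurableI_greater) (simp add: haar_space haar_sets)
qed

text \<open>The layers of the section function are open, so inner regularity reduces them to compact
  sets. The constant is made of two factors of two: one from passing to dyadic layers, one from
  \<open>sum_compact_level_le\<close>.\<close>

lemma nn_integral_section_le:
  assumes U: "open U" and V: "open V" and V_fin: "emeasure \<mu> V < \<infinity>"
  shows "(\<integral>\<^sup>+x. emeasure \<mu> {y\<in>V. - y + x \<in> U} \<partial>\<mu>) \<le> 4 * (emeasure \<mu> V * emeasure \<mu> U)"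
proof -
  define \<phi> where "\<phi> x = emeasure \<mu> {y\<in>V. - y + x \<in> U}" for x
  have \<phi>_less: "\<phi> x < top" for x
  proof -
    have "\<phi> x \<le> emeasure \<mu> V"
      unfolding \<phi>_def using V by (intro emeasure_mono) (auto simp: haar_sets)
    then show ?thesis using V_fin by (simp add: order.strict_trans1)
  qed
  define O' where "O' n = {x. dyadic n < \<phi> x}" for n
  have O': "open (O' n)" for n
    unfolding O'_def \<phi>_def by (rule borel_measurable_section[OF U V])
  have ind: "indicator {dyadic n<..} (\<phi> x) = (indicator (O' n) x :: ennreal)" for n x
    by (simp add: O'_def indicator_def)
  have [measurable]: "O' n \<in> sets \<mu>" for n using O' by (simp add: haar_sets)
  have part: "(\<Sum>n<m. dyadic n * emeasure \<mu> (O' n)) \<le> 2 * (emeasure \<mu> V * emeasure \<mu> U)" for m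
  proof -
    \<comment> \<open>The leading \<open>0\<close> is the accumulator \<open>c\<close> of
      \<open>sum_SUP_le_ennreal\<close>.\<close>
    have "0 + (\<Sum>n<m. dyadic n * (SUP K\<in>{K. compact K \<and> K \<subseteq> O' n}. emeasure \<mu> K))
      \<le> 2 * (emeasure \<mu> V * emeasure \<mu> U)"
    proof (rule sum_SUP_le_ennreal)
      fix K assume K: "\<And>i. i \<in> {..<m} \<Longrightarrow> K i \<in> {K. compact K \<and> K \<subseteq> O' i}"
      have "(\<Sum>n<m. dyadic n * emeasure \<mu> (K n)) \<le> 2 * (emeasure \<mu> V * emeasure \<mu> U)"
      proof (rule sum_compact_level_le[OF U V V_fin])
        show "K n \<subseteq> {x. dyadic n < emeasure \<mu> {y\<in>V. - y + x \<in> U}}" if "n \<in> {..<m}" for n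
          using K[OF that] by (simp add: O'_def \<phi>_def)
      qed (use K in \<open>simp_all only: sum_dyadic_le finite_lessThan mem_Collect_eq\<close>)
      then show "0 + (\<Sum>n<m. dyadic n * emeasure \<mu> (K n)) \<le> 2 * (emeasure \<mu> V * emeasure \<mu> U)"
        by simp
    qed auto
    then show ?thesis by (simp add: haar_inner[OF O'])
  qed
  have "(\<integral>\<^sup>+x. \<phi> x \<partial>\<mu>) \<le> (\<integral>\<^sup>+x. 2 * suminf (\<lambda>n. dyadic n * indicator (O' n) x) \<partial>\<mu>)"
    using le_suminf_dyadic[OF \<phi>_less] by (intro nn_integral_mono) (simp add: ind)
  also have "\<dots> = 2 * suminf (\<lambda>n. dyadic n * emeasure \<mu> (O' n))"
    by (subst nn_integral_cmult) (auto simp: nn_integral_suminf nn_integral_cmult_indicator)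
  also have "\<dots> \<le> 2 * (2 * (emeasure \<mu> V * emeasure \<mu> U))"
    by (intro mult_left_mono suminf_le_const part summableI) auto
  finally show ?thesis by (simp add: \<phi>_def mult.assoc[symmetric])
qed

section \<open>Domination by open sets and integrability of the convolution integrand\<close>

lemma open_dyadic_cover:
  fixes f :: "'g \<Rightarrow> ennreal"
  assumes f: "f \<in> borel_measurable \<mu>" and f_fin: "\<And>y. f y < top"
    and int: "(\<integral>\<^sup>+y. f y \<partial>\<mu>) < top"
  obtains U :: "nat \<Rightarrow> 'g set" where "\<And>n. open (U n)"
    and "\<And>y. f y \<le> 2 * suminf (\<lambda>n. dyadic n * indicator (U n) y)"
    and "suminf (\<lambda>n. dyadic n * emeasure \<mu> (U n)) < top"
proof -
  define A where "A n = {y. dyadic n < f y}" for n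
  have A[measurable]: "A n \<in> sets \<mu>" for n
    using measurable_sets[OF f, of "{dyadic n<..}"] by (simp add: A_def haar_space vimage_def)
  have ind: "indicator {dyadic n<..} (f y) = (indicator (A n) y :: ennreal)" for n y
    by (simp add: A_def indicator_def)
  have part: "(\<Sum>n<m. dyadic n * indicator (A n) y) \<le> 2 * f y" for m y
    using sum_dyadic_le[OF finite_lessThan, of "f y" m] unfolding ind .
  have "suminf (\<lambda>n. dyadic n * emeasure \<mu> (A n)) = (\<integral>\<^sup>+y. suminf (\<lambda>n. dyadic n * indicator (A n) y) \<partial>\<mu>)"
    by (simp add: nn_integral_suminf nn_integral_cmult_indicator)
  also have "\<dots> \<le> (\<integral>\<^sup>+y. 2 * f y \<partial>\<mu>)"
    by (intro nn_integral_mono suminf_le_const summableI part)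
  also have "\<dots> < top"
    using int f by (simp add: nn_integral_cmult ennreal_mult_less_top)
  finally have A_sum: "suminf (\<lambda>n. dyadic n * emeasure \<mu> (A n)) < top" .
  \<comment> \<open>The allowance is chosen so that the weighted excess of the \<open>n\<close>-th
    open set is at most \<open>(1/2) ^ n\<close>, which is summable.\<close>
  define e where "e n = ennreal ((1/2) ^ n / 2 powr real_of_int (int_decode n))" for n
  have e: "0 < e n" "dyadic n * e n = ennreal ((1/2) ^ n)" for n
    by (simp_all add: e_def dyadic_def ennreal_mult'[symmetric])
  have "\<exists>U. open U \<and> A n \<subseteq> U \<and> emeasure \<mu> U < emeasure \<mu> (A n) + e n" for n
  proof -
    have "dyadic n * emeasure \<mu> (A n) = (\<Sum>k\<in>{n}. dyadic k * emeasure \<mu> (A k))" by simp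
    also have "\<dots> \<le> suminf (\<lambda>n. dyadic n * emeasure \<mu> (A n))"
      by (intro sum_le_suminf summableI) auto
    finally have "dyadic n * emeasure \<mu> (A n) < top" using A_sum by simp
    then have "emeasure \<mu> (A n) < top"
      using dyadic_pos[of n] by (auto simp: ennreal_mult_less_top)
    \<comment> \<open>The inequality is strict because the layer has finite measure; outer
      regularity then yields an open set within the allowance.\<close>
    then have "emeasure \<mu> (A n) + 0 < emeasure \<mu> (A n) + e n"
      using e(1)[of n] unfolding ennreal_add_left_cancel_less by simp
    then have "emeasure \<mu> (A n) < emeasure \<mu> (A n) + e n" by simp
    moreover have "emeasure \<mu> (A n) = (INF U\<in>{U. open U \<and> A n \<subseteq> U}. emeasure \<mu> U)"
      using A[of n] by (intro haar_outer) (simp add: haar_sets)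
    ultimately have "(INF U\<in>{U. open U \<and> A n \<subseteq> U}. emeasure \<mu> U) < emeasure \<mu> (A n) + e n"
      by simp
    then show ?thesis unfolding INF_less_iff by blast
  qed
  then obtain U where U: "\<And>n. open (U n)" "\<And>n. A n \<subseteq> U n"
    "\<And>n. emeasure \<mu> (U n) < emeasure \<mu> (A n) + e n" by metis
  show thesis
  proof
    show "open (U n)" for n by (rule U)
    show "f y \<le> 2 * suminf (\<lambda>n. dyadic n * indicator (U n) y)" for y
    proof -
      have "f y \<le> 2 * suminf (\<lambda>n. dyadic n * indicator (A n) y)"
        using le_suminf_dyadic[OF f_fin[of y]] by (simp add: ind)
      also have "\<dots> \<le> 2 * suminf (\<lambda>n. dyadic n * indicator (U n) y)"
        using U(2) by (intro mult_left_mono suminf_le summableI) (auto simp: indicator_def)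
      finally show ?thesis .
    qed
    have "suminf (\<lambda>n. dyadic n * emeasure \<mu> (U n))
        \<le> suminf (\<lambda>n. dyadic n * emeasure \<mu> (A n) + ennreal ((1/2) ^ n))"
      using U(3) by (intro suminf_le summableI)
        (metis e(2) distrib_left less_imp_le mult_left_mono zero_le)
    also have "\<dots> = suminf (\<lambda>n. dyadic n * emeasure \<mu> (A n)) + suminf (\<lambda>n. ennreal ((1/2) ^ n))"
      by (intro suminf_add[symmetric] summableI)
    also have "suminf (\<lambda>n. ennreal ((1/2) ^ n)) = ennreal (suminf (\<lambda>n. (1/2) ^ n))"
      by (intro suminf_ennreal2 summable_geometric) auto
    finally show "suminf (\<lambda>n. dyadic n * emeasure \<mu> (U n)) < top"
      using A_sum by (simp add: order.strict_trans1)
  qed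
qed

text \<open>\<open>f\<close> and \<open>g\<close> are dominated by series over open sets
  \<open>V j\<close> and \<open>U k\<close>. The integral over \<open>y\<close> of the product of
  these series is, up to a constant, a double series \<open>\<Phi> x\<close> whose own integral is
  finite, so it is finite for almost every \<open>x\<close>.\<close>

lemma AE_integrable_conv:
  assumes f: "integrable \<mu> f" and g: "integrable \<mu> g"
  shows "AE x in \<mu>. integrable \<mu> (\<lambda>y. f y * g (- y + x) :: complex)"
proof -
  have fin: "(\<integral>\<^sup>+y. ennreal (cmod (h y)) \<partial>\<mu>) < top" if "integrable \<mu> h" for h :: "'g \<Rightarrow> complex"
    using that by (simp add: integrable_iff_bounded)
  have [measurable]: "f \<in> borel_measurable \<mu>" "g \<in> borel_measurable \<mu>" using f g by auto
  obtain V where V: "\<And>n. open (V n)"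
      "\<And>y. ennreal (cmod (f y)) \<le> 2 * suminf (\<lambda>n. dyadic n * indicator (V n) y)"
      "suminf (\<lambda>n. dyadic n * emeasure \<mu> (V n)) < top"
    by (rule open_dyadic_cover[OF _ _ fin[OF f]]) auto
  obtain U where U: "\<And>n. open (U n)"
      "\<And>y. ennreal (cmod (g y)) \<le> 2 * suminf (\<lambda>n. dyadic n * indicator (U n) y)"
      "suminf (\<lambda>n. dyadic n * emeasure \<mu> (U n)) < top"
    by (rule open_dyadic_cover[OF _ _ fin[OF g]]) auto
  define \<phi> where "\<phi> j k x = emeasure \<mu> {y\<in>V j. - y + x \<in> U k}" for j k x
  have \<phi>[measurable]: "\<phi> j k \<in> borel_measurable \<mu>" for j k
    unfolding \<phi>_def by (rule borel_measurable_section(1)[OF U(1) V(1)])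
  have V_fin: "emeasure \<mu> (V j) < \<infinity>" for j
  proof -
    have "dyadic j * emeasure \<mu> (V j) = (\<Sum>k\<in>{j}. dyadic k * emeasure \<mu> (V k))" by simp
    also have "\<dots> \<le> suminf (\<lambda>n. dyadic n * emeasure \<mu> (V n))"
      by (intro sum_le_suminf summableI) auto
    finally have "dyadic j * emeasure \<mu> (V j) < top" using V(3) by simp
    then show ?thesis using dyadic_pos[of j] by (auto simp: ennreal_mult_less_top)
  qed
  define \<Phi> where "\<Phi> x = suminf (\<lambda>j. suminf (\<lambda>k. dyadic j * dyadic k * \<phi> j k x))" for x
  have \<Phi>[measurable]: "\<Phi> \<in> borel_measurable \<mu>" unfolding \<Phi>_def by measurable
  have "(\<integral>\<^sup>+x. \<Phi> x \<partial>\<mu>) = suminf (\<lambda>j. suminf (\<lambda>k. dyadic j * dyadic k * (\<integral>\<^sup>+x. \<phi> j k x \<partial>\<mu>)))"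
    unfolding \<Phi>_def by (simp add: nn_integral_suminf nn_integral_cmult)
  also have "\<dots> \<le> suminf (\<lambda>j. suminf (\<lambda>k. 4 * (dyadic j * emeasure \<mu> (V j)) * (dyadic k * emeasure \<mu> (U k))))"
  proof (intro suminf_le summableI)
    fix j k
    have "dyadic j * dyadic k * (\<integral>\<^sup>+x. \<phi> j k x \<partial>\<mu>)
        \<le> dyadic j * dyadic k * (4 * (emeasure \<mu> (V j) * emeasure \<mu> (U k)))"
      unfolding \<phi>_def by (intro mult_left_mono nn_integral_section_le U V V_fin) auto
    then show "dyadic j * dyadic k * (\<integral>\<^sup>+x. \<phi> j k x \<partial>\<mu>)
        \<le> 4 * (dyadic j * emeasure \<mu> (V j)) * (dyadic k * emeasure \<mu> (U k))"
      by (simp add: ac_simps)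
  qed
  also have "\<dots> = 4 * suminf (\<lambda>j. dyadic j * emeasure \<mu> (V j)) * suminf (\<lambda>k. dyadic k * emeasure \<mu> (U k))"
    by (simp add: ennreal_suminf_cmult ennreal_suminf_multc)
  also have "\<dots> < top" using U(3) V(3) by (simp add: ennreal_mult_less_top)
  finally have "AE x in \<mu>. \<Phi> x \<noteq> \<infinity>" by (intro nn_integral_PInf_AE) auto
  then show ?thesis
  proof (rule AE_mp, intro AE_I2 impI)
    fix x assume x: "\<Phi> x \<noteq> \<infinity>"
    have shift: "(\<lambda>y. - y + x) \<in> measurable \<mu> \<mu>"
      unfolding measurable_cong_sets[OF haar_sets haar_sets]
      by (intro borel_measurable_continuous_onI continuous_intros)
    have gs[measurable]: "(\<lambda>y. g (- y + x)) \<in> borel_measurable \<mu>"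
      by (rule measurable_compose[OF shift]) simp
    have sec[measurable]: "{y\<in>V j. - y + x \<in> U k} \<in> sets \<mu>" for j k
      using open_section[OF U(1) V(1)] by (simp add: haar_sets)
    have prod_2: "(2 * a) * (2 * b) = 4 * (a * b)" for a b :: ennreal
    proof -
      have "(2 * a) * (2 * b) = (2 * 2) * (a * b)" by (simp only: ac_simps)
      then show ?thesis by simp
    qed
    have "(\<integral>\<^sup>+y. ennreal (cmod (f y * g (- y + x))) \<partial>\<mu>)
        \<le> (\<integral>\<^sup>+y. 4 * suminf (\<lambda>j. suminf (\<lambda>k. dyadic j * dyadic k * indicator {y\<in>V j. - y + x \<in> U k} y)) \<partial>\<mu>)"
    proof (rule nn_integral_mono)
      fix y
      have "ennreal (cmod (f y * g (- y + x))) = ennreal (cmod (f y)) * ennreal (cmod (g (- y + x)))"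
        by (simp add: norm_mult ennreal_mult')
      also have "\<dots> \<le> (2 * suminf (\<lambda>n. dyadic n * indicator (V n) y))
          * (2 * suminf (\<lambda>n. dyadic n * indicator (U n) (- y + x)))"
        by (intro mult_mono U V) auto
      also have "\<dots> = 4 * (suminf (\<lambda>n. dyadic n * indicator (V n) y)
          * suminf (\<lambda>n. dyadic n * indicator (U n) (- y + x)))"
        by (rule prod_2)
      also have "\<dots> = 4 * suminf (\<lambda>j. suminf (\<lambda>k. dyadic j * indicator (V j) y * (dyadic k * indicator (U k) (- y + x))))"
        by (simp add: ennreal_suminf_cmult ennreal_suminf_multc)
      also have "\<dots> = 4 * suminf (\<lambda>j. suminf (\<lambda>k. dyadic j * dyadic k * indicator {y\<in>V j. - y + x \<in> U k} y))"
        by (intro arg_cong[where f="\<lambda>z. 4 * z"] suminf_cong) (auto simp: indicator_def)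
      finally show "ennreal (cmod (f y * g (- y + x))) \<le> \<dots>" .
    qed
    also have "\<dots> = 4 * \<Phi> x"
      by (simp add: nn_integral_cmult nn_integral_suminf nn_integral_cmult_indicator \<Phi>_def \<phi>_def)
    also have "\<dots> < top" using x by (simp add: ennreal_mult_less_top less_top)
    finally show "integrable \<mu> (\<lambda>y. f y * g (- y + x))"
      by (intro integrableI_bounded) auto
  qed
qed

text \<open>Additivity of the Bochner integral needs both integrands integrable, which
  \<open>AE_integrable_conv\<close> grants for almost every \<open>x\<close>.\<close>

lemma AE_conv_add_left:
  assumes "integrable \<mu> f" "integrable \<mu> f'" "integrable \<mu> g"
  shows "AE x in \<mu>. conv \<mu> (f + f') g x = conv \<mu> f g x + conv \<mu> f' g x"
  using AE_integrable_conv[OF assms(1,3)] AE_integrable_conv[OF assms(2,3)]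
  by eventually_elim (simp add: conv_def distrib_right)

lemma AE_conv_add_right:
  assumes "integrable \<mu> f" "integrable \<mu> g" "integrable \<mu> g'"
  shows "AE x in \<mu>. conv \<mu> f (g + g') x = conv \<mu> f g x + conv \<mu> f g' x"
  using AE_integrable_conv[OF assms(1,2)] AE_integrable_conv[OF assms(1,3)]
  by eventually_elim (simp add: conv_def distrib_left)

end

text \<open>Holds at every point: the Bochner integral commutes with scalars even where it is zero
  by convention.\<close>

lemma conv_scale_left: "conv \<mu> (fscale c f) g = fscale c (conv \<mu> f g)"
  by (simp add: conv_def fscale_def fun_eq_iff mult.assoc)

lemma conv_scale_right: "conv \<mu> f (fscale c g) = fscale c (conv \<mu> f g)"
  by (simp add: conv_def fscale_def fun_eq_iff mult.left_commute)

section \<open>The theorem for Segal algebras\<close>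

lemma seminormed_algebra_conv:
  fixes \<mu> :: "'g::{topological_group_add, t2_space} measure"
  assumes haar: "left_haar_measure \<mu>" and segal: "segal_algebra \<mu> S N"
  shows "seminormed_algebra (conv_algebra \<mu> S N)"
proof -
  interpret vector_space "fscale :: complex \<Rightarrow> ('g \<Rightarrow> complex) \<Rightarrow> 'g \<Rightarrow> complex"
    by (rule vector_space_fscale)
  have sub: "subspace S" and dense: "dense_in (norm1 \<mu>) S (L1 \<mu>)"
    and tri: "\<forall>f\<in>S. \<forall>g\<in>S. N (f + g) \<le> N f + N g"
    and hom: "\<forall>c. \<forall>f\<in>S. N (fscale c f) = cmod c * N f"
    and null: "\<forall>f\<in>S. N f = 0 \<longleftrightarrow> (AE x in \<mu>. f x = 0)"
    and compl: "\<forall>u. (\<forall>n::nat. u n \<in> S) \<and> (\<forall>e>0. \<exists>M. \<forall>m\<ge>M. \<forall>n\<ge>M. N (u m - u n) < e) \<longrightarrow>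
          (\<exists>f\<in>S. (\<lambda>n. N (u n - f)) \<longlonglongrightarrow> 0)"
    and ideal: "\<forall>f\<in>L1 \<mu>. \<forall>g\<in>S. conv \<mu> f g \<in> S \<and> N (conv \<mu> f g) \<le> norm1 \<mu> f * N g"
    and embed: "\<forall>f\<in>S. norm1 \<mu> f \<le> N f"
    using segal unfolding segal_algebra_def by - (elim conjE, assumption)+
  have S_L1: "f \<in> L1 \<mu>" "integrable \<mu> f" if "f \<in> S" for f
    using dense that by (auto simp: dense_in_def L1_def)
  interpret S: seminormed_space "conv_algebra \<mu> S N"
    by unfold_locales (use sub tri hom in \<open>simp_all add: conv_algebra_def scale_right_distrib scale_left_distrib\<close>)
  have closed: "conv \<mu> f g \<in> S" if "f \<in> S" "g \<in> S" for f g
    using ideal S_L1 that by blast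
  \<comment> \<open>Identities valid almost everywhere become differences of seminorm zero, the form
    in which the locale asks for bilinearity.\<close>
  have null_diff: "N (f - g - h) = 0" if "f \<in> S" "g \<in> S" "h \<in> S" "AE x in \<mu>. f x = g x + h x" for f g h
  proof -
    have "f - g - h \<in> S" using that sub by (intro subspace_diff) auto
    moreover have "AE x in \<mu>. (f - g - h) x = 0" using that(4) by eventually_elim simp
    ultimately show ?thesis using null by blast
  qed
  have S_add: "f + g \<in> S" if "f \<in> S" "g \<in> S" for f g using that sub by (rule subspace_add[rotated])
  show ?thesis
  proof unfold_locales
    fix x y assume "x \<in> carr (conv_algebra \<mu> S N)" "y \<in> carr (conv_algebra \<mu> S N)"
    then have xy: "x \<in> S" "y \<in> S" by (simp_all add: conv_algebra_def)
    \<comment> \<open>The module bound involves the \<open>L1\<close> norm of the left factor, which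
      the contractive embedding replaces by \<open>N\<close>.\<close>
    have "N (conv \<mu> x y) \<le> norm1 \<mu> x * N y" using ideal S_L1 xy by blast
    also have "\<dots> \<le> N x * N y"
      using embed xy S.snorm_nonneg[of y] by (intro mult_right_mono) (auto simp: conv_algebra_def)
    finally show "snorm (conv_algebra \<mu> S N) (mult (conv_algebra \<mu> S N) x y)
        \<le> 1 * snorm (conv_algebra \<mu> S N) x * snorm (conv_algebra \<mu> S N) y"
      by (simp add: conv_algebra_def)
  next
    fix u :: "nat \<Rightarrow> 'g \<Rightarrow> complex"
    assume "\<And>n. u n \<in> carr (conv_algebra \<mu> S N)"
      and "\<And>e. 0 < e \<Longrightarrow> \<exists>M. \<forall>m\<ge>M. \<forall>n\<ge>M. snorm (conv_algebra \<mu> S N) (u m - u n) < e"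
    then show "\<exists>f\<in>carr (conv_algebra \<mu> S N). (\<lambda>n. snorm (conv_algebra \<mu> S N) (u n - f)) \<longlonglongrightarrow> 0"
      using compl by (simp add: conv_algebra_def)
  qed (auto simp: conv_algebra_def conv_scale_left conv_scale_right closed S_L1 S_add
      intro!: null_diff AE_conv_add_left[OF haar] AE_conv_add_right[OF haar]
      S.snorm_zero[unfolded conv_algebra_def, simplified])
qed

theorem theorem3p6:
  fixes \<mu> :: "'g::{topological_group_add, t2_space} measure"
    and S :: "('g \<Rightarrow> complex) set"
    and N :: "('g \<Rightarrow> complex) \<Rightarrow> real"
    and D :: "('g \<Rightarrow> complex) \<Rightarrow> ('g \<Rightarrow> complex) \<Rightarrow> complex"
  defines "A \<equiv> conv_algebra \<mu> S N"
  assumes "locally_compact_space (euclidean :: 'g topology)"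
    and "left_haar_measure \<mu>"
    and "symmetric_segal_algebra \<mu> S N"
    and "continuous_derivation A (regular_bimodule A) D"
  shows "wstar_approx_inner A (tensor_bimodule A) (\<lambda>f. D f \<circ> tensor_mult A)"
proof -
  have "segal_algebra \<mu> S N"
    using assms(4) unfolding symmetric_segal_algebra_def by (rule conjunct1)
  then interpret seminormed_algebra A
    unfolding A_def by (rule seminormed_algebra_conv[OF assms(3)])
  show ?thesis using assms(5) by (rule pullback_derivation_inner)
qed

end
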